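(* Let $a, b, n$ be integers with $n \ge 3$ and $16 < b < a < \frac{6b}{5}$. Define $\eta \in (0,1]$ by $a - b = a^{1-\eta}$. Then $$\mu_{\rm eff}\Bigl(\sqrt[n]{a/b}\Bigr) \le \frac{35.1}{\eta}\,\max\Bigl\{\frac{\log 2n}{\eta\log a},\ 10\Bigr\}^2,$$ where $\sqrt[n]{a/b}$ denotes the positive real $n$-th root of $a/b$.
   Context: For an irrational real number $\xi$, a real number $\mu$ is an effective irrationality measure for $\xi$ if for every $\varepsilon>0$ there is an effectively computable constant $C(\xi,\varepsilon)>0$ such that every rational number $p/q$ with $q\ge 1$ satisfies $|\xi - p/q| > C(\xi,\varepsilon)\, q^{-\mu-\varepsilon}$. $\mu_{\rm eff}(\xi)$ denotes the infimum of the effective irrationality measures of $\xi$. $\log$ is the natural logarithm.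
   Formalization: The formal theorem additionally assumes that the n-th root of a/b is irrational, since μ_eff is defined only for irrational numbers and the hypotheses allow rational roots, e.g. a = 17³, b = 16³, n = 3. *)

theory Defs
  imports "HOL-Library.Extended_Real"
begin

text \<open>Kleene's total general recursive functions of arity \<open>m\<close>, acting on argument lists of length
  \<open>m\<close>. Minimization is only allowed for functions that have a zero for every choice of the
  parameters, so that every function generated is total; the last rule says that the values on lists
  of length other than \<open>m\<close> are irrelevant.\<close>

inductive recursive_fn :: "nat \<Rightarrow> (nat list \<Rightarrow> nat) \<Rightarrow> bool" where
  zero: "recursive_fn m (\<lambda>xs. 0)"
| succ: "recursive_fn 1 (\<lambda>xs. Suc (hd xs))"
| proj: "i < m \<Longrightarrow> recursive_fn m (\<lambda>xs. xs ! i)"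
| comp: "recursive_fn (length gs) f \<Longrightarrow> (\<forall>g\<in>set gs. recursive_fn m g) \<Longrightarrow>
    recursive_fn m (\<lambda>xs. f (map (\<lambda>g. g xs) gs))"
| prim_rec: "recursive_fn m f \<Longrightarrow> recursive_fn (m + 2) g \<Longrightarrow>
    recursive_fn (Suc m) (\<lambda>xs. rec_nat (f (tl xs)) (\<lambda>y r. g (y # r # tl xs)) (hd xs))"
| minimize: "recursive_fn (Suc m) f \<Longrightarrow> (\<forall>xs. length xs = m \<longrightarrow> (\<exists>y. f (y # xs) = 0)) \<Longrightarrow>
    recursive_fn m (\<lambda>xs. LEAST y. f (y # xs) = 0)"
| ext: "recursive_fn m f \<Longrightarrow> (\<forall>xs. length xs = m \<longrightarrow> f xs = g xs) \<Longrightarrow> recursive_fn m g"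

text \<open>A real number depending on \<open>m\<close> natural numbers is effectively computable if one algorithm
  returns, for all arguments and every \<open>j\<close>, an integer numerator (here a difference of two
  naturals) of a rational approximation with denominator \<open>j + 1\<close> and error at most
  \<open>1 / (j + 1)\<close>.\<close>

definition computable_real_fn :: "nat \<Rightarrow> (nat list \<Rightarrow> real) \<Rightarrow> bool" where
  "computable_real_fn m C \<longleftrightarrow>
    (\<exists>f g. recursive_fn (Suc m) f \<and> recursive_fn (Suc m) g \<and>
      (\<forall>xs j. length xs = m \<longrightarrow>
        \<bar>C xs - (real (f (j # xs)) - real (g (j # xs))) / real (Suc j)\<bar> \<le> 1 / real (Suc j)))"

text \<open>\<open>C k\<close> is the constant used for every real \<open>\<epsilon> \<ge> 1 / k\<close>: an algorithm cannot take an arbitrary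
  real \<open>\<epsilon>\<close> as input, and since \<open>q \<ge> 1\<close> a constant that is valid for \<open>1 / k\<close> is valid for every larger
  \<open>\<epsilon>\<close>.

  The procedure \<open>C\<close> is a parameter because effectivity is a property of the dependence of the
  constant on \<open>\<xi>\<close> and \<open>\<epsilon>\<close>. For one fixed \<open>\<xi>\<close> the mere existence of a computable \<open>C\<close> carries no
  information: if any positive constant works for some exponent, then so does a positive rational
  one. Computability is therefore to be imposed on \<open>C\<close> as a function of data describing \<open>\<xi>\<close>
  together with \<open>k\<close>.\<close>

definition irrationality_measure_with :: "(nat \<Rightarrow> real) \<Rightarrow> real \<Rightarrow> real \<Rightarrow> bool" where
  "irrationality_measure_with C \<xi> \<mu> \<longleftrightarrow>
    (\<forall>\<epsilon>>0. \<forall>k>0. 1 / real k \<le> \<epsilon> \<longrightarrow>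
      C k > 0 \<and>
      (\<forall>p q :: int. q \<ge> 1 \<longrightarrow>
        \<bar>\<xi> - real_of_int p / real_of_int q\<bar> > C k * real_of_int q powr (- \<mu> - \<epsilon>)))"

text \<open>Extended reals, so that the infimum is \<open>\<infinity>\<close> if there is no such exponent.\<close>

definition mu_eff :: "(nat \<Rightarrow> real) \<Rightarrow> real \<Rightarrow> ereal" where
  "mu_eff C \<xi> = Inf {ereal \<mu> | \<mu>. irrationality_measure_with C \<xi> \<mu>}"

end

theory Submission
  imports Defs "Jordan_Normal_Form.Determinant"
begin

text \<open>
  Put \<open>z = a / b\<close>, \<open>\<xi> = z\<^bsup>1/n\<^esup>\<close> and let \<open>w = p / q\<close> be a very good approximation of \<open>\<xi>\<close>. For integers \<open>c t s\<close> consider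
  \<open>\<Phi>(k, l) = (\<Sum>t<T. \<Sum>s<S. c t s * C(n k + l + B, t) * (z\<^sup>k w\<^sup>l)\<^sup>s)\<close> on integer points \<open>(k, l)\<close> of the diamond
  \<open>\<bar>k\<bar> ln a + \<bar>l\<bar> ln q \<le> L ln q\<close>. If \<open>w\<close> is replaced by \<open>\<xi>\<close>, this becomes an exponential polynomial in the single
  variable \<open>m = n k + l\<close>. The pigeonhole principle yields small integers \<open>c t s\<close>, not all zero, for which the low order
  Taylor coefficients of that function are tiny; the high order ones are tiny because \<open>ln z\<close> is about \<open>a powr - \<eta>\<close>.
  Hence all \<open>\<bar>\<Phi>(k, l)\<bar>\<close> are small, unless \<open>w\<close> is far from \<open>\<xi>\<close>. A zero estimate provides a point of
  the diamond with \<open>\<Phi>(k, l) \<noteq> 0\<close>, where the denominator of this rational number bounds \<open>\<bar>\<Phi>(k, l)\<bar>\<close> from below.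
  The parameters \<open>S\<close> and \<open>L\<close> are proportional to \<open>\<Lambda>\<close> and \<open>\<Lambda> / \<eta>\<close>, where \<open>\<Lambda>\<close> is the maximum in the theorem,
  and \<open>T\<close> is proportional to \<open>ln q\<close>. Liouville's inequality covers \<open>n \<le> 35.1 \<Lambda>\<^sup>2 / \<eta>\<close> and small \<open>q\<close>.
\<close>

section \<open>Computable constants\<close>

text \<open>The polynomial factor is evaluated at integers of size about \<open>n * M * L\<close>,
  which grows with \<open>q\<close>. Powers would cost the logarithm of that size; binomials are
  integers too but cost only \<open>ln (4 * B / T)\<close>, where \<open>4 * B / T\<close> is about
  \<open>2 * n * S / L\<close>. This is the origin of \<open>ln (2 * n)\<close>, and \<Lambda> makes
  it at most \<open>\<Lambda> * u\<close> with \<open>u = \<eta> * ln a\<close>. The entry 10 of the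
  maximum keeps the rounding of \<open>S\<close> and \<open>L\<close> harmless. The constant 35.1
  comes from balancing exponents. In units of \<open>S * T * u / 2\<close>, for large
  \<open>u\<close> and \<open>\<Lambda> = 10\<close>, the heights of the coefficients cost
  \<open>11 / (10 * \<sigma> + 1)\<close>, the denominators \<open>\<sigma> * \<zeta>\<close> and
  the Taylor conditions \<open>\<theta>\<^sup>2\<close>, while the closeness of \<open>w\<close>
  gains \<open>2 * \<theta>\<close> with \<open>\<theta> = (35.1 / 2) * \<zeta>\<^sup>2\<close>. The
  gain just wins near \<open>\<sigma> = 2.1\<close> and \<open>\<zeta> = 0.22\<close>. All other
  losses are negligible once \<open>q\<close> exceeds an explicit power of \<open>a\<close> that
  depends only on \<open>a\<close> and \<open>n\<close>. So one recursive function of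
  \<open>a\<close>, \<open>b\<close>, \<open>n\<close> yields the constant, without any loss in the
  exponent.\<close>

lemma recursive_compose2:
  assumes "recursive_fn 2 f" "recursive_fn m g" "recursive_fn m h"
  shows "recursive_fn m (\<lambda>xs. f [g xs, h xs])"
  using recursive_fn.comp[of "[g, h]" f m] assms by (simp add: numeral_2_eq_2)

lemma recursive_compose1:
  assumes "recursive_fn 1 f" "recursive_fn m g"
  shows "recursive_fn m (\<lambda>xs. f [g xs])"
  using recursive_fn.comp[of "[g]" f m] assms by simp

lemma length_2_conv: "length xs = 2 \<longleftrightarrow> (\<exists>x y. xs = [x, y])"
  by (auto simp: numeral_2_eq_2 length_Suc_conv)

lemma recursive_Suc:
  assumes "recursive_fn m g" shows "recursive_fn m (\<lambda>xs. Suc (g xs))"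
  using recursive_compose1[OF recursive_fn.succ assms] by simp

lemma recursive_const: "recursive_fn m (\<lambda>xs. c)"
  by (induction c) (auto intro: recursive_fn.zero recursive_Suc)

lemma recursive_prim_rec2:
  assumes "recursive_fn 1 f" "recursive_fn 3 g"
    and "\<And>y. F 0 y = f [y]" "\<And>x y. F (Suc x) y = g [x, F x y, y]"
  shows "recursive_fn 2 (\<lambda>xs. F (xs ! 0) (xs ! 1))"
proof -
  have F: "rec_nat (f [y]) (\<lambda>x r. g [x, r, y]) x = F x y" for x y
    by (induction x) (use assms in auto)
  have "recursive_fn (Suc 1) (\<lambda>xs. rec_nat (f (tl xs)) (\<lambda>y r. g (y # r # tl xs)) (hd xs))"
    using assms by (intro recursive_fn.prim_rec) (auto simp: eval_nat_numeral)
  then have "recursive_fn 2 (\<lambda>xs. rec_nat (f (tl xs)) (\<lambda>y r. g (y # r # tl xs)) (hd xs))"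
    by (simp add: numeral_2_eq_2)
  then show ?thesis by (rule recursive_fn.ext) (auto simp: length_2_conv F)
qed

lemma recursive_add:
  assumes "recursive_fn m g" "recursive_fn m h" shows "recursive_fn m (\<lambda>xs. g xs + h xs)"
proof -
  have "recursive_fn 2 (\<lambda>xs. xs ! 0 + xs ! 1)"
    by (rule recursive_prim_rec2[where f="\<lambda>xs. xs ! 0" and g="\<lambda>xs. Suc (xs ! 1)"])
      (intro recursive_Suc recursive_fn.proj | simp)+
  from recursive_compose2[OF this assms] show ?thesis by simp
qed

lemma recursive_mult:
  assumes "recursive_fn m g" "recursive_fn m h" shows "recursive_fn m (\<lambda>xs. g xs * h xs)"
proof -
  have "recursive_fn 2 (\<lambda>xs. xs ! 0 * xs ! 1)"
    by (rule recursive_prim_rec2[where f="\<lambda>xs. 0" and g="\<lambda>xs. xs ! 1 + xs ! 2"])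
      (intro recursive_add recursive_const recursive_fn.proj | simp)+
  from recursive_compose2[OF this assms] show ?thesis by simp
qed

lemma recursive_power:
  assumes "recursive_fn m g" "recursive_fn m h" shows "recursive_fn m (\<lambda>xs. g xs ^ h xs)"
proof -
  have "recursive_fn 2 (\<lambda>xs. (\<lambda>x y. y ^ x) (xs ! 0) (xs ! 1))"
    by (rule recursive_prim_rec2[where f="\<lambda>xs. 1" and g="\<lambda>xs. xs ! 1 * xs ! 2"])
      (intro recursive_mult recursive_const recursive_fn.proj | simp)+
  from recursive_compose2[OF this assms(2,1)] show ?thesis by simp
qed

lemma recursive_diff:
  assumes "recursive_fn m g" "recursive_fn m h" shows "recursive_fn m (\<lambda>xs. g xs - h xs)"
proof -
  have "recursive_fn 2 (\<lambda>xs. (\<lambda>x y. x - 1) (xs ! 0) (xs ! 1))"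
    by (rule recursive_prim_rec2[where f="\<lambda>xs. 0" and g="\<lambda>xs. xs ! 0"])
      (intro recursive_const recursive_fn.proj | simp)+
  then have p: "recursive_fn k (\<lambda>xs. g xs - 1)" if "recursive_fn k g" for k g
    using recursive_compose2[OF _ that that] by fastforce
  have "recursive_fn 2 (\<lambda>xs. (\<lambda>x y. y - x) (xs ! 0) (xs ! 1))"
    by (rule recursive_prim_rec2[where f="\<lambda>xs. xs ! 0" and g="\<lambda>xs. xs ! 1 - 1"])
      (intro p recursive_fn.proj | simp)+
  from recursive_compose2[OF this assms(2,1)] show ?thesis by simp
qed

text \<open>The quotient is the least \<open>y\<close> with
  \<open>Suc x < Suc y * Suc (h xs)\<close>; truncated subtraction turns this comparison into a zero
  test. The divisor is a successor, so a zero exists for all parameters, as \<open>minimize\<close>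
  demands.\<close>

lemma recursive_hd_div:
  assumes "recursive_fn m h"
  shows "recursive_fn (Suc m) (\<lambda>xs. Suc (hd xs) div Suc (h (tl xs)))"
proof -
  have h: "recursive_fn (Suc (Suc m)) (\<lambda>xs. h (tl (tl xs)))"
  proof -
    define gs where "gs = map (\<lambda>i (xs :: nat list). xs ! (i + 2)) [0..<m]"
    have "recursive_fn (Suc (Suc m)) (\<lambda>xs. h (map (\<lambda>g. g xs) gs))"
      using assms by (intro recursive_fn.comp) (auto simp: gs_def intro: recursive_fn.proj)
    then show ?thesis
    proof (rule recursive_fn.ext, intro allI impI)
      fix xs :: "nat list" assume "length xs = Suc (Suc m)"
      then have "map (\<lambda>g. g xs) gs = tl (tl xs)"
        by (intro nth_equalityI) (auto simp: gs_def nth_tl)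
      then show "h (map (\<lambda>g. g xs) gs) = h (tl (tl xs))" by simp
    qed
  qed
  define F where "F xs = Suc (Suc (xs ! 1)) - Suc (xs ! 0) * Suc (h (tl (tl xs)))" for xs
  have "recursive_fn (Suc (Suc m)) F"
    unfolding F_def
    by (intro recursive_diff recursive_mult recursive_Suc h recursive_fn.proj) auto
  moreover have F0: "F (y # x # xs) = 0 \<longleftrightarrow> Suc x div Suc (h xs) \<le> y" for y x xs
    by (simp add: F_def less_eq_Suc_le[symmetric] div_less_iff_less_mult flip: less_Suc_eq_le)
  ultimately have "recursive_fn (Suc m) (\<lambda>xs. LEAST y. F (y # xs) = 0)"
    by (intro recursive_fn.minimize) (auto simp: length_Suc_conv)
  then show ?thesis
    by (rule recursive_fn.ext) (auto simp: length_Suc_conv F0 intro!: Least_equality)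
qed

text \<open>Rounding \<open>(j + 1) / (h xs + 1)\<close> down already meets the error
  \<open>1 / (j + 1)\<close>; the numerator is nonnegative, so its subtracted part can be 0.\<close>

lemma computable_inverse:
  assumes "recursive_fn m h"
  shows "computable_real_fn m (\<lambda>xs. 1 / real (Suc (h xs)))"
  unfolding computable_real_fn_def
proof (intro exI conjI allI impI)
  show "recursive_fn (Suc m) (\<lambda>xs. Suc (hd xs) div Suc (h (tl xs)))" using assms by (rule recursive_hd_div)
  show "recursive_fn (Suc m) (\<lambda>xs. 0)" by (rule recursive_fn.zero)
  fix xs :: "nat list" and j :: nat
  define x where "x = real (Suc j) / real (Suc (h xs))"
  have fl: "real (Suc j div Suc (h xs)) = of_int \<lfloor>x\<rfloor>"
    unfolding x_def by (simp only: floor_divide_of_nat_eq of_int_of_nat_eq)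
  have "1 / real (Suc (h xs)) - (of_int \<lfloor>x\<rfloor> - 0) / real (Suc j) = (x - of_int \<lfloor>x\<rfloor>) / real (Suc j)"
    by (simp add: x_def diff_divide_distrib)
  moreover have "\<bar>x - of_int \<lfloor>x\<rfloor>\<bar> \<le> 1" by linarith
  ultimately show "\<bar>1 / real (Suc (h xs)) - (real (Suc (hd (j # xs)) div Suc (h (tl (j # xs)))) - real 0) / real (Suc j)\<bar>
      \<le> 1 / real (Suc j)"
    unfolding list.sel fl by (simp add: abs_div divide_right_mono)
qed

section \<open>Liouville's inequality\<close>

text \<open>With \<open>w = p / q\<close>, the number \<open>b * q^n * (w^n - \<xi>^n)\<close> is
  the integer \<open>b * p^n - a * q^n\<close>, nonzero by irrationality, and
  \<open>w^n - \<xi>^n\<close> is at most \<open>n * 3^n\<close> times the distance. The root is at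
  most 2, so \<open>w\<close> is at most 3 in modulus unless the distance exceeds 1.\<close>

lemma liouville_root:
  fixes a b n q :: nat and p :: int
  assumes b: "b > 0" and ab: "a \<le> 2 * b" and n: "n > 0" and q: "q > 0"
    and irr: "root n (real a / real b) \<notin> \<rat>"
  shows "1 / (real b * real n * 3 ^ n * real q ^ n) \<le> \<bar>root n (real a / real b) - of_int p / real q\<bar>"
proof -
  define \<xi> where "\<xi> = root n (real a / real b)"
  define w where "w = of_int p / real q"
  have z2: "real a / real b \<le> 2" using ab b by (simp add: divide_simps)
  have \<xi>0: "\<xi> \<ge> 0" by (simp add: \<xi>_def n)
  have \<xi>n: "\<xi> ^ n = real a / real b" using n by (simp add: \<xi>_def)
  have \<xi>2: "\<xi> \<le> 2"
  proof (rule ccontr)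
    assume "\<not> \<xi> \<le> 2"
    then have "2 < \<xi>" by simp
    moreover have "\<xi> ^ 1 \<le> \<xi> ^ n" using \<open>2 < \<xi>\<close> n by (intro power_increasing) auto
    ultimately show False using \<xi>n z2 by simp
  qed
  have wq: "w \<in> \<rat>" unfolding w_def by simp
  show ?thesis
  proof (cases "\<bar>\<xi> - w\<bar> \<le> 1")
    case False
    have "1 \<le> real b * real n * 3 ^ n * real q ^ n"
    proof -
      have "1 \<le> b * n * 3 ^ n * q ^ n" using b n q by (simp add: Suc_le_eq)
      then have "real 1 \<le> real (b * n * 3 ^ n * q ^ n)" by (simp only: of_nat_le_iff)
      then show ?thesis by simp
    qed
    then have "1 / (real b * real n * 3 ^ n * real q ^ n) \<le> 1" by simp
    then show ?thesis using False unfolding \<xi>_def w_def by linarith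
  next
    case True
    have w3: "\<bar>w\<bar> \<le> 3" using True \<xi>0 \<xi>2 by linarith
    \<comment> \<open>For even \<open>n\<close> the rational \<open>w\<close> might be minus the
      root, so absolute values are compared.\<close>
    have ne: "w ^ n \<noteq> \<xi> ^ n"
    proof
      assume eq: "w ^ n = \<xi> ^ n"
      have "\<bar>w\<bar> ^ n = \<bar>w ^ n\<bar>" by (simp add: power_abs)
      also have "\<dots> = \<xi> ^ n" using \<xi>0 by (simp add: eq)
      finally have "\<bar>w\<bar> ^ n = \<xi> ^ n" .
      then have "\<bar>w\<bar> = \<xi>" by (rule power_eq_imp_eq_base) (use n \<xi>0 in auto)
      moreover have "\<bar>w\<bar> \<in> \<rat>" using wq by simp
      ultimately show False using irr unfolding \<xi>_def[symmetric] by simp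
    qed
    have "1 \<le> \<bar>real b * real q ^ n * (w ^ n - \<xi> ^ n)\<bar>"
    proof -
      have "real b * real q ^ n * (w ^ n - \<xi> ^ n) = of_int (int b * p ^ n - int a * int q ^ n)"
        using q b unfolding \<xi>n w_def by (simp add: power_divide right_diff_distrib)
      then have "real b * real q ^ n * (w ^ n - \<xi> ^ n) \<in> \<int>" by (simp only: Ints_of_int)
      moreover have "real b * real q ^ n * (w ^ n - \<xi> ^ n) \<noteq> 0" using ne b q by simp
      ultimately show ?thesis by (rule Ints_nonzero_abs_ge1)
    qed
    also have "\<bar>real b * real q ^ n * (w ^ n - \<xi> ^ n)\<bar> = real b * real q ^ n * \<bar>w ^ n - \<xi> ^ n\<bar>"
      by (simp add: abs_mult)
    also have "\<bar>w ^ n - \<xi> ^ n\<bar> \<le> \<bar>\<xi> - w\<bar> * (real n * 3 ^ n)"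
    proof -
      have "w ^ n - \<xi> ^ n = (w - \<xi>) * (\<Sum>i<n. \<xi> ^ (n - Suc i) * w ^ i)" by (rule power_diff_sumr2)
      moreover have "\<bar>\<Sum>i<n. \<xi> ^ (n - Suc i) * w ^ i\<bar> \<le> (\<Sum>i<n. 3 ^ n)"
      proof (rule order_trans[OF sum_abs], rule sum_mono)
        fix i assume i: "i \<in> {..<n}"
        have "\<bar>\<xi> ^ (n - Suc i) * w ^ i\<bar> = \<xi> ^ (n - Suc i) * \<bar>w\<bar> ^ i" using \<xi>0 by (simp add: abs_mult power_abs)
        also have "\<dots> \<le> 3 ^ (n - Suc i) * 3 ^ i" using \<xi>0 \<xi>2 w3 by (intro mult_mono power_mono) auto
        also have "\<dots> = 3 ^ (n - Suc i + i)" by (simp add: power_add)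
        also have "\<dots> \<le> 3 ^ n" using i by (intro power_increasing) auto
        finally show "\<bar>\<xi> ^ (n - Suc i) * w ^ i\<bar> \<le> 3 ^ n" .
      qed
      ultimately show ?thesis by (simp add: abs_mult abs_minus_commute mult_left_mono)
    qed
    finally have "1 \<le> real b * real q ^ n * (\<bar>\<xi> - w\<bar> * (real n * 3 ^ n))" using b q by (simp add: mult_left_mono)
    then have "1 \<le> \<bar>\<xi> - w\<bar> * (real b * real n * 3 ^ n * real q ^ n)" by (simp add: mult_ac)
    then show ?thesis using b n q unfolding \<xi>_def w_def by (simp add: pos_divide_le_eq)
  qed
qed

section \<open>A zero estimate\<close>

text \<open>A kernel vector of the transpose lists the coefficients of a nonzero polynomial of
  degree below \<open>k\<close> with \<open>k\<close> distinct roots.\<close>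

lemma det_vandermonde_nonzero:
  fixes x :: "nat \<Rightarrow> real"
  assumes "inj_on x {..<k}"
  shows "det (mat k k (\<lambda>(i, j). x j ^ i)) \<noteq> 0"
proof
  assume "det (mat k k (\<lambda>(i, j). x j ^ i)) = 0"
  then have "det (transpose_mat (mat k k (\<lambda>(i, j). x j ^ i))) = 0"
    using det_transpose[of "mat k k (\<lambda>(i, j). x j ^ i)" k] by simp
  then obtain v where v: "v \<in> carrier_vec k" "v \<noteq> 0\<^sub>v k"
    "transpose_mat (mat k k (\<lambda>(i, j). x j ^ i)) *\<^sub>v v = 0\<^sub>v k"
    using det_0_iff_vec_prod_zero[of "transpose_mat (mat k k (\<lambda>(i, j). x j ^ i))" k] by auto
  define P where "P = (\<Sum>i<k. monom (v $ i) i)"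
  have coeffP: "coeff P i = (if i < k then v $ i else 0)" for i
    unfolding P_def by (simp add: coeff_sum sum.delta' if_distrib cong: if_cong)
  have root: "poly P (x j) = 0" if "j < k" for j
  proof -
    have "0 = (transpose_mat (mat k k (\<lambda>(i, j). x j ^ i)) *\<^sub>v v) $ j"
      using v(3) that by simp
    also have "\<dots> = (\<Sum>i<k. x j ^ i * v $ i)"
      using that v(1) by (simp add: scalar_prod_def atLeast0LessThan)
    finally show ?thesis
      by (simp add: P_def poly_sum poly_monom mult.commute)
  qed
  obtain i where i: "i < k" "v $ i \<noteq> 0"
    using v(1,2) by (metis carrier_vecD eq_vecI index_zero_vec(1) index_zero_vec(2))
  then have P0: "P \<noteq> 0" using coeffP[of i] by auto
  have deg: "degree P < k"
    using coeffP i(1) P0 by (metis leading_coeff_0_iff)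
  have "k = card (x ` {..<k})" using assms by (simp add: card_image)
  also have "\<dots> \<le> card {y. poly P y = 0}"
    by (rule card_mono) (use root P0 poly_roots_finite in auto)
  also have "\<dots> \<le> degree P" using P0 by (rule card_poly_roots_bound)
  finally show False using deg by simp
qed

lemma coeff_prod_sum:
  fixes f :: "'i \<Rightarrow> 'a :: comm_ring_1 poly"
  assumes "finite I" "\<And>i. i \<in> I \<Longrightarrow> degree (f i) \<le> d i"
  shows "coeff (prod f I) (sum d I) = (\<Prod>i\<in>I. coeff (f i) (d i)) \<and> degree (prod f I) \<le> sum d I"
  using assms
proof (induction I rule: finite_induct)
  case empty
  then show ?case by simp
next
  case (insert i I)
  have *: "degree (f i) \<le> d i" "degree (prod f I) \<le> sum d I"
    "coeff (prod f I) (sum d I) = (\<Prod>i\<in>I. coeff (f i) (d i))"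
    using insert by auto
  have "coeff (f i * prod f I) (d i + sum d I) = coeff (f i) (d i) * coeff (prod f I) (sum d I)"
  proof -
    have "coeff (f i * prod f I) (d i + sum d I) = 
      (\<Sum>j\<le>d i + sum d I. coeff (f i) j * coeff (prod f I) (d i + sum d I - j))"
      by (rule coeff_mult)
    also have "\<dots> = (\<Sum>j\<in>{d i}. coeff (f i) j * coeff (prod f I) (d i + sum d I - j))"
    proof (rule sum.mono_neutral_right)
      show "\<forall>j\<in>{..d i + sum d I} - {d i}. coeff (f i) j * coeff (prod f I) (d i + sum d I - j) = 0"
      proof
        fix j assume j: "j \<in> {..d i + sum d I} - {d i}"
        show "coeff (f i) j * coeff (prod f I) (d i + sum d I - j) = 0"
        proof (cases "j > d i")
          case True
          then have "coeff (f i) j = 0" using *(1) by (intro coeff_eq_0) auto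
          then show ?thesis by simp
        next
          case False
          then have "coeff (prod f I) (d i + sum d I - j) = 0"
            using j *(2) by (intro coeff_eq_0) auto
          then show ?thesis by simp
        qed
      qed
    qed auto
    finally show ?thesis by simp
  qed
  moreover have "degree (f i * prod f I) \<le> d i + sum d I"
    using degree_mult_le[of "f i" "prod f I"] * by linarith
  ultimately show ?case using insert * by simp
qed

text \<open>Each term of the Leibniz expansion takes one entry from every column. Degree bounds per
  column therefore add up to the same total for all permutations, and the top coefficients again
  form a determinant.\<close>

lemma det_poly_mat_lead:
  fixes A :: "'a :: comm_ring_1 poly mat"
  assumes A: "A \<in> carrier_mat k k"
    and deg: "\<And>i j. i < k \<Longrightarrow> j < k \<Longrightarrow> degree (A $$ (i, j)) \<le> d j"
  shows "coeff (det A) (\<Sum>j<k. d j) = det (mat k k (\<lambda>(i, j). coeff (A $$ (i, j)) (d j)))"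
    and "degree (det A) \<le> (\<Sum>j<k. d j)"
proof -
  let ?P = "{p. p permutes {0..<k}}"
  have dA: "det A = (\<Sum>p\<in>?P. signof p * (\<Prod>j<k. A $$ (p j, j)))"
    using A by (rule det_col)
  have *: "coeff (\<Prod>j<k. A $$ (p j, j)) (\<Sum>j<k. d j) = (\<Prod>j<k. coeff (A $$ (p j, j)) (d j))
      \<and> degree (\<Prod>j<k. A $$ (p j, j)) \<le> (\<Sum>j<k. d j)" if "p \<in> ?P" for p
    by (rule coeff_prod_sum) (use that deg in \<open>auto simp: permutes_in_image atLeast0LessThan\<close>)
  have s: "signof p * c = (if sign p = 1 then c else - c)" for p :: "nat \<Rightarrow> nat" and c :: "'a poly"
    by (simp add: sign_def)
  have s': "signof p * c = (if sign p = 1 then c else - c)" for p :: "nat \<Rightarrow> nat" and c :: 'a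
    by (simp add: sign_def)
  show "degree (det A) \<le> (\<Sum>j<k. d j)"
    unfolding dA s by (rule degree_sum_le) (use * in \<open>auto simp: finite_permutations\<close>)
  have "coeff (det A) (\<Sum>j<k. d j) = (\<Sum>p\<in>?P. signof p * (\<Prod>j<k. coeff (A $$ (p j, j)) (d j)))"
    unfolding dA coeff_sum s s' using * by (intro sum.cong) auto
  also have "\<dots> = det (mat k k (\<lambda>(i, j). coeff (A $$ (i, j)) (d j)))"
  proof -
    have "det (mat k k (\<lambda>(i, j). coeff (A $$ (i, j)) (d j))) =
      (\<Sum>p\<in>?P. signof p * (\<Prod>j<k. mat k k (\<lambda>(i, j). coeff (A $$ (i, j)) (d j)) $$ (p j, j)))"
      by (rule det_col) simp
    also have "\<dots> = (\<Sum>p\<in>?P. signof p * (\<Prod>j<k. coeff (A $$ (p j, j)) (d j)))"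
      by (intro sum.cong prod.cong refl arg_cong2[where f="(*)"])
        (auto simp: permutes_in_image)
    finally show ?thesis by simp
  qed
  finally show "coeff (det A) (\<Sum>j<k. d j) = det (mat k k (\<lambda>(i, j). coeff (A $$ (i, j)) (d j)))" .
qed

lemma degree_pcompose_linear: "degree (pcompose p [:c, 1:]) = degree (p :: real poly)"
  by (simp add: degree_pcompose)

lemma lead_coeff_pcompose_linear: "coeff (pcompose p [:c, 1:]) (degree p) = coeff (p :: real poly) (degree p)"
  using lead_coeff_comp[of "[:c,1:]" p] by (simp add: degree_pcompose)

text \<open>Suppose all values vanish. Shifting \<open>k\<close> by \<open>i\<close> multiplies the
  \<open>s\<close>-th exponential by \<open>z ^ (s * i)\<close>, so the exponentials at
  \<open>(k, l)\<close> form a nonzero kernel vector of a matrix whose entries are polynomials in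
  \<open>U = n * k + l\<close>. Its determinant is a nonzero polynomial of degree at most
  \<open>(T - 1) * S\<close>, yet it vanishes at the distinct numbers \<open>U\<close> coming from
  \<open>X\<close>.\<close>

lemma exp_poly_zero_estimate:
  fixes Q :: "nat \<Rightarrow> real poly" and z w n :: real and X :: "(int \<times> int) set"
  assumes z: "z > 1" and w: "w > 0"
    and deg: "\<And>s. s < S \<Longrightarrow> degree (Q s) < T"
    and nz: "\<exists>s<S. Q s \<noteq> 0"
    and inj: "inj_on (\<lambda>(k, l). n * of_int k + of_int l :: real) X"
    and fin: "finite X" and big: "(T - 1) * S < card X"
  shows "\<exists>(k, l)\<in>X. \<exists>i<S. (\<Sum>s<S. poly (Q s) (n * of_int (k + int i) + of_int l) *
           (z powi (k + int i) * w powi l) ^ s) \<noteq> 0"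
proof (rule ccontr)
  assume "\<not> ?thesis"
  then have vanish: "(\<Sum>s<S. poly (Q s) (n * of_int (k + int i) + of_int l) *
           (z powi (k + int i) * w powi l) ^ s) = 0" if "(k, l) \<in> X" "i < S" for k l i
    using that by blast
  \<comment> \<open>Zero polynomials are dropped, so that every column has a nonzero leading
    coefficient; the \<open>m\<close> remaining columns use the first \<open>m \<le> S\<close>
    shifts.\<close>
  define \<sigma> where "\<sigma> = sorted_list_of_set {s. s < S \<and> Q s \<noteq> 0}"
  define m where "m = length \<sigma>"
  have set\<sigma>: "set \<sigma> = {s. s < S \<and> Q s \<noteq> 0}" and dist: "distinct \<sigma>"
    unfolding \<sigma>_def by auto
  have mS: "m \<le> S"
    using distinct_card[OF dist] card_mono[of "{..<S}" "set \<sigma>"] set\<sigma> unfolding m_def by auto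
  have m0: "m > 0" using nz set\<sigma> unfolding m_def by fastforce
  have \<sigma>j: "\<sigma> ! j < S" "Q (\<sigma> ! j) \<noteq> 0" if "j < m" for j
    using that set\<sigma> nth_mem[of j \<sigma>] unfolding m_def by auto
  define A where "A = mat m m (\<lambda>(i, j). smult ((z ^ (\<sigma> ! j)) ^ i) (pcompose (Q (\<sigma> ! j)) [:n * real i, 1:]))"
  have A: "A \<in> carrier_mat m m" unfolding A_def by simp
  define d where "d j = degree (Q (\<sigma> ! j))" for j
  have degA: "degree (A $$ (i, j)) \<le> d j" if "i < m" "j < m" for i j
    using that z by (simp add: A_def d_def degree_pcompose_linear)
  have "coeff (det A) (\<Sum>j<m. d j) = det (mat m m (\<lambda>(i, j). coeff (A $$ (i, j)) (d j)))"
    by (rule det_poly_mat_lead[OF A degA])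
  \<comment> \<open>Translating the argument preserves leading coefficients, so the top coefficients
    form a Vandermonde matrix in the distinct numbers \<open>z ^ (\<sigma> ! j)\<close> with
    rescaled columns.\<close>
  also have "mat m m (\<lambda>(i, j). coeff (A $$ (i, j)) (d j)) =
      mat m m (\<lambda>(i, j). (z ^ (\<sigma> ! j)) ^ i) * mat m m (\<lambda>(i, j). if i = j then lead_coeff (Q (\<sigma> ! j)) else 0)"
    by (rule eq_matI)
      (auto simp: A_def d_def lead_coeff_pcompose_linear scalar_prod_def if_distrib sum.delta cong: if_cong)
  also have "det \<dots> = det (mat m m (\<lambda>(i, j). (z ^ (\<sigma> ! j)) ^ i)) *
      det (mat m m (\<lambda>(i, j). if i = j then lead_coeff (Q (\<sigma> ! j)) else 0))"
    by (rule det_mult) auto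
  also have "\<dots> \<noteq> 0"
  proof -
    have "inj_on (\<lambda>j. z ^ (\<sigma> ! j)) {..<m}"
      using z dist nth_eq_iff_index_eq[OF dist] by (intro inj_onI) (auto simp: m_def)
    then have "det (mat m m (\<lambda>(i, j). (z ^ (\<sigma> ! j)) ^ i)) \<noteq> 0"
      by (rule det_vandermonde_nonzero)
    moreover have "det (mat m m (\<lambda>(i, j). if i = j then lead_coeff (Q (\<sigma> ! j)) else 0)) =
       prod_list (diag_mat (mat m m (\<lambda>(i, j). if i = j then lead_coeff (Q (\<sigma> ! j)) else 0)))"
      by (rule det_upper_triangular[where n=m]) (auto simp: upper_triangular_def)
    moreover have "prod_list (diag_mat (mat m m (\<lambda>(i, j). if i = j then lead_coeff (Q (\<sigma> ! j)) else 0))) \<noteq> 0"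
      using \<sigma>j by (auto simp: prod_list_zero_iff diag_mat_def)
    ultimately show ?thesis by simp
  qed
  finally have nzc: "coeff (det A) (\<Sum>j<m. d j) \<noteq> 0" .
  then have det0: "det A \<noteq> 0" by auto
  have "degree (det A) \<le> (\<Sum>j<m. d j)" by (rule det_poly_mat_lead[OF A degA])
  also have "\<dots> \<le> (\<Sum>j<m. T - 1)"
    using deg \<sigma>j unfolding d_def by (intro sum_mono) (metis Suc_pred less_Suc_eq_le lessThan_iff less_imp_le_nat not_less_zero neq0_conv diff_Suc_1 Suc_leI le_diff_conv add.commute Suc_eq_plus1)
  also have "\<dots> \<le> (T - 1) * S" using mS by simp
  finally have degdet: "degree (det A) \<le> (T - 1) * S" .
  have root: "poly (det A) (n * of_int k + of_int l) = 0" if kl: "(k, l) \<in> X" for k l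
  proof -
    define U where "U = n * of_int k + of_int l"
    define B where "B = map_mat (\<lambda>p. poly p U) A"
    have B: "B \<in> carrier_mat m m" using A unfolding B_def by simp
    define v where "v = vec m (\<lambda>j. (z powi k * w powi l) ^ (\<sigma> ! j))"
    have "B *\<^sub>v v = 0\<^sub>v m"
    proof (rule eq_vecI)
      fix i assume "i < dim_vec (0\<^sub>v m)"
      then have i: "i < m" by simp
      have "(B *\<^sub>v v) $ i = (\<Sum>j<m. (z ^ (\<sigma> ! j)) ^ i * poly (Q (\<sigma> ! j)) (n * real i + U) *
          (z powi k * w powi l) ^ (\<sigma> ! j))"
        using i A by (simp add: B_def v_def scalar_prod_def A_def atLeast0LessThan poly_pcompose)
      also have "\<dots> = (\<Sum>j<m. poly (Q (\<sigma> ! j)) (n * of_int (k + int i) + of_int l) *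
          (z powi (k + int i) * w powi l) ^ (\<sigma> ! j))"
        using z by (intro sum.cong) (auto simp: U_def algebra_simps power_int_add power_mult_distrib
          simp flip: power_mult)
      also have "\<dots> = (\<Sum>s\<in>set \<sigma>. poly (Q s) (n * of_int (k + int i) + of_int l) *
          (z powi (k + int i) * w powi l) ^ s)"
        unfolding m_def by (rule sum.reindex_bij_betw) (use bij_betw_nth[OF dist] in blast)
      also have "\<dots> = (\<Sum>s<S. poly (Q s) (n * of_int (k + int i) + of_int l) *
          (z powi (k + int i) * w powi l) ^ s)"
        by (rule sum.mono_neutral_left) (auto simp: set\<sigma>)
      also have "\<dots> = 0" using vanish[OF kl] i mS by simp
      finally show "(B *\<^sub>v v) $ i = 0\<^sub>v m $ i" using i by simp
    qed (use B in auto)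
    moreover have "v \<noteq> 0\<^sub>v m"
    proof
      assume "v = 0\<^sub>v m"
      then have "v $ 0 = 0" using m0 by simp
      then show False using m0 z w by (simp add: v_def)
    qed
    ultimately have "det B = 0"
      using det_0_iff_vec_prod_zero[OF B] vec_carrier[of m] unfolding v_def by metis
    moreover have "det B = poly (det A) U"
    proof -
      interpret comm_ring_hom "\<lambda>p. poly p U" by unfold_locales auto
      show ?thesis unfolding B_def by (simp add: hom_det)
    qed
    ultimately show ?thesis by (simp add: U_def)
  qed
  have "card X = card ((\<lambda>(k, l). n * of_int k + of_int l :: real) ` X)"
    using inj by (simp add: card_image)
  also have "\<dots> \<le> card {y. poly (det A) y = 0}"
    by (rule card_mono) (use root det0 poly_roots_finite in auto)
  also have "\<dots> \<le> degree (det A)" using det0 by (rule card_poly_roots_bound)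
  finally show False using degdet big by simp
qed

section \<open>The pigeonhole principle and Taylor coefficients\<close>

text \<open>The box principle with a separate height for each unknown and a separate number
  \<open>g d + 1\<close> of boxes of width \<open>\<delta>\<close> for each form. This freedom
  matters because Taylor coefficients of higher order are smaller and need fewer boxes.\<close>

lemma small_linear_forms:
  fixes A :: "nat \<Rightarrow> 'i \<Rightarrow> real" and h :: "'i \<Rightarrow> nat" and g :: "nat \<Rightarrow> nat"
  assumes I: "finite I" and \<delta>: "\<delta> > 0"
    and A: "\<And>d. d < D \<Longrightarrow> (\<Sum>i\<in>I. real (h i) * \<bar>A d i\<bar>) < \<delta> * (real (g d) + 1)"
    and card: "(\<Prod>d<D. g d + 1) < (\<Prod>i\<in>I. h i + 1)"
  obtains c :: "'i \<Rightarrow> int" where "\<exists>i\<in>I. c i \<noteq> 0" "\<And>i. i \<in> I \<Longrightarrow> \<bar>c i\<bar> \<le> int (h i)"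
    "\<And>d. d < D \<Longrightarrow> \<bar>\<Sum>i\<in>I. of_int (c i) * A d i\<bar> \<le> \<delta>"
proof -
  define C where "C = PiE I (\<lambda>i. {..h i})"
  \<comment> \<open>The minimum of the form over \<open>C\<close>; subtracting it puts the scaled
    values between 0 and \<open>g d + 1\<close>.\<close>
  define low where "low d = (\<Sum>i\<in>I. real (h i) * min (A d i) 0)" for d
  define val where "val x d = ((\<Sum>i\<in>I. real (x i) * A d i) - low d) / \<delta>" for x :: "'i \<Rightarrow> nat" and d
  define \<phi> where "\<phi> x = restrict (\<lambda>d. nat \<lfloor>val x d\<rfloor>) {..<D}" for x
  have val: "0 \<le> val x d \<and> val x d < real (g d) + 1" if x: "x \<in> C" and d: "d < D" for x d
  proof -
    have xi: "real (x i) \<le> real (h i)" if "i \<in> I" for i using x that by (auto simp: C_def)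
    have *: "real (h i) * min (A d i) 0 \<le> real (x i) * A d i" if "i \<in> I" for i
      using xi[OF that] by (cases "A d i \<ge> 0") (auto simp: min_def intro: mult_right_mono_neg)
    then have "low d \<le> (\<Sum>i\<in>I. real (x i) * A d i)"
      unfolding low_def by (intro sum_mono)
    moreover have **: "real (x i) * A d i - real (h i) * min (A d i) 0 \<le> real (h i) * \<bar>A d i\<bar>" if "i \<in> I" for i
    proof (cases "A d i \<ge> 0")
      case True
      then show ?thesis using xi[OF that] by (auto simp: min_def intro: mult_right_mono)
    next
      case False
      then have "real (x i) * A d i \<le> 0" by (simp add: mult_nonneg_nonpos)
      then show ?thesis using False by (simp add: min_def)
    qed
    have "(\<Sum>i\<in>I. real (x i) * A d i) - low d \<le> (\<Sum>i\<in>I. real (h i) * \<bar>A d i\<bar>)"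
      unfolding low_def sum_subtractf[symmetric] by (intro sum_mono **)
    ultimately show ?thesis using A[OF d] \<delta> by (auto simp: val_def divide_simps mult.commute)
  qed
  have "\<phi> ` C \<subseteq> PiE {..<D} (\<lambda>d. {..g d})"
  proof
    fix y assume "y \<in> \<phi> ` C"
    then obtain x where x: "x \<in> C" "y = \<phi> x" by auto
    have "nat \<lfloor>val x d\<rfloor> \<le> g d" if "d < D" for d
      using val[OF x(1) that] by (simp add: nat_le_iff floor_le_iff)
    then show "y \<in> PiE {..<D} (\<lambda>d. {..g d})" using x(2) by (auto simp: \<phi>_def)
  qed
  then have "card (\<phi> ` C) \<le> card (PiE {..<D} (\<lambda>d. {..g d}))"
    by (intro card_mono finite_PiE) auto
  also have "\<dots> = (\<Prod>d<D. g d + 1)" by (simp add: card_PiE)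
  also have "\<dots> < (\<Prod>i\<in>I. h i + 1)" by (rule card)
  also have "\<dots> = card C" using I by (simp add: C_def card_PiE)
  finally have "\<not> inj_on \<phi> C" by (rule pigeonhole)
  then obtain x y where xy: "x \<in> C" "y \<in> C" "x \<noteq> y" "\<phi> x = \<phi> y" by (auto simp: inj_on_def)
  define c where "c i = int (x i) - int (y i)" for i
  show ?thesis
  proof
    show "\<exists>i\<in>I. c i \<noteq> 0"
    proof (rule ccontr)
      assume "\<not> ?thesis"
      then have "x i = y i" if "i \<in> I" for i using that by (auto simp: c_def)
      then have "x = y" using xy(1,2) unfolding C_def by (intro PiE_ext) auto
      then show False using xy(3) by simp
    qed
    show "\<bar>c i\<bar> \<le> int (h i)" if "i \<in> I" for i
    proof -
      have "x i \<le> h i" "y i \<le> h i" using xy(1,2) that by (auto simp: C_def)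
      then show ?thesis by (simp add: c_def)
    qed
    show "\<bar>\<Sum>i\<in>I. of_int (c i) * A d i\<bar> \<le> \<delta>" if d: "d < D" for d
    proof -
      have "nat \<lfloor>val x d\<rfloor> = nat \<lfloor>val y d\<rfloor>"
        using fun_cong[OF xy(4), of d] d by (simp add: \<phi>_def)
      then have "\<lfloor>val x d\<rfloor> = \<lfloor>val y d\<rfloor>"
        using val[OF xy(1) d] val[OF xy(2) d] by (simp add: nat_eq_iff)
      then have "\<bar>val x d - val y d\<bar> \<le> 1" by linarith
      moreover have "val x d - val y d = (\<Sum>i\<in>I. of_int (c i) * A d i) / \<delta>"
        by (simp add: val_def c_def diff_divide_distrib[symmetric] sum_subtractf[symmetric] algebra_simps)
      ultimately show ?thesis using \<delta> by (simp add: abs_div)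
    qed
  qed
qed

text \<open>These are the Taylor coefficients at 0 of \<open>P (B y) exp (\<alpha> y)\<close>. The
  rescaling by \<open>B\<close> moves the integers of modulus at most \<open>B\<close> into the unit
  interval.\<close>

definition exp_poly_coeff :: "real poly \<Rightarrow> real \<Rightarrow> real \<Rightarrow> nat \<Rightarrow> real" where
  "exp_poly_coeff P B \<alpha> d =
    (\<Sum>i\<le>degree P. coeff P i * B ^ i * (if i \<le> d then \<alpha> ^ (d - i) / fact (d - i) else 0))"

lemma exp_poly_coeff_sums:
  "(\<lambda>d. exp_poly_coeff P B \<alpha> d * y ^ d) sums (poly P (B * y) * exp (\<alpha> * y))"
proof -
  have shift: "(\<lambda>d. (if i \<le> d then \<alpha> ^ (d - i) / fact (d - i) else 0) * y ^ d) sums (y ^ i * exp (\<alpha> * y))"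
    (is "?g sums _") for i
  proof -
    have "(\<lambda>n. (\<alpha> * y) ^ n /\<^sub>R fact n) sums exp (\<alpha> * y)" by (rule exp_converges)
    then have "(\<lambda>n. y ^ i * ((\<alpha> * y) ^ n /\<^sub>R fact n)) sums (y ^ i * exp (\<alpha> * y))" by (rule sums_mult)
    moreover have "(\<lambda>n. y ^ i * ((\<alpha> * y) ^ n /\<^sub>R fact n)) = (\<lambda>n. ?g (n + i))"
      by (simp add: fun_eq_iff power_add power_mult_distrib divide_inverse mult_ac)
    ultimately have "(\<lambda>n. ?g (n + i)) sums (y ^ i * exp (\<alpha> * y))" by simp
    then show ?thesis by (subst (asm) sums_iff_shift) simp
  qed
  have "(\<lambda>d. \<Sum>i\<le>degree P. coeff P i * B ^ i * ((if i \<le> d then \<alpha> ^ (d - i) / fact (d - i) else 0) * y ^ d))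
      sums (\<Sum>i\<le>degree P. coeff P i * B ^ i * (y ^ i * exp (\<alpha> * y)))"
    by (intro sums_sum sums_mult shift)
  moreover have "(\<Sum>i\<le>degree P. coeff P i * B ^ i * (y ^ i * exp (\<alpha> * y))) = poly P (B * y) * exp (\<alpha> * y)"
    by (simp add: poly_altdef power_mult_distrib sum_distrib_left sum_distrib_right mult_ac)
  ultimately show ?thesis
    by (simp add: exp_poly_coeff_def sum_distrib_right mult.assoc)
qed

text \<open>This is Cauchy's estimate on the circle of radius \<open>r\<close>, obtained by real
  means: as the coefficients are nonnegative, \<open>P (B y)\<close> is there at most
  \<open>P (B r)\<close>, hence at most \<open>r ^ t * P B\<close>.\<close>

lemma exp_poly_coeff_bound:
  assumes nonneg: "\<And>i. coeff P i \<ge> 0" and B: "B \<ge> 0" and deg: "degree P \<le> t"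
    and \<alpha>: "\<bar>\<alpha>\<bar> \<le> Y" and r: "r \<ge> 1"
  shows "\<bar>exp_poly_coeff P B \<alpha> d\<bar> \<le> poly P B * r ^ t * exp (r * Y) / r ^ d"
proof -
  have Y: "Y \<ge> 0" using \<alpha> by linarith
  have one: "\<bar>if i \<le> d then \<alpha> ^ (d - i) / fact (d - i) else 0\<bar> \<le> r ^ t * exp (r * Y) / r ^ d"
    if "i \<le> degree P" for i
  proof (cases "i \<le> d")
    case True
    have "\<bar>\<alpha> ^ (d - i) / fact (d - i)\<bar> \<le> Y ^ (d - i) / fact (d - i)"
      using \<alpha> by (simp add: power_abs abs_div divide_right_mono power_mono)
    also have "\<dots> = (r * Y) ^ (d - i) / fact (d - i) * r ^ i / r ^ d"
      using True r by (simp add: power_mult_distrib power_diff)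
    also have "\<dots> \<le> exp (r * Y) * r ^ t / r ^ d"
    proof (intro divide_right_mono mult_mono)
      have s: "summable (\<lambda>n. (r * Y) ^ n /\<^sub>R fact n)" by (rule summable_exp_generic)
      have "sum (\<lambda>n. (r * Y) ^ n /\<^sub>R fact n) {d - i} \<le> (\<Sum>n. (r * Y) ^ n /\<^sub>R fact n)"
        using r Y by (intro sum_le_suminf s) auto
      then show "(r * Y) ^ (d - i) / fact (d - i) \<le> exp (r * Y)"
        by (simp add: exp_def divide_inverse mult.commute)
      show "r ^ i \<le> r ^ t" using r that deg by (intro power_increasing) auto
    qed (use r Y in auto)
    finally show ?thesis using True by (simp add: mult.commute)
  qed (use r in auto)
  have "\<bar>exp_poly_coeff P B \<alpha> d\<bar> \<le> (\<Sum>i\<le>degree P. coeff P i * B ^ i * (r ^ t * exp (r * Y) / r ^ d))"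
    unfolding exp_poly_coeff_def
  proof (rule order_trans[OF sum_abs], rule sum_mono)
    fix i assume "i \<in> {..degree P}"
    then show "\<bar>coeff P i * B ^ i * (if i \<le> d then \<alpha> ^ (d - i) / fact (d - i) else 0)\<bar>
      \<le> coeff P i * B ^ i * (r ^ t * exp (r * Y) / r ^ d)"
      using one[of i] nonneg[of i] B unfolding abs_mult by (intro mult_mono) auto
  qed
  also have "\<dots> = poly P B * (r ^ t * exp (r * Y) / r ^ d)"
    unfolding poly_altdef by (rule sum_distrib_right[symmetric])
  finally show ?thesis by simp
qed

text \<open>A Schwarz lemma for series: \<open>D\<close> coefficients are small by construction, and
  the others are dominated by a geometric series with first term \<open>\<delta>\<close> and ratio
  at most 1/2, which adds at most \<open>2 * \<delta>\<close>.\<close>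

lemma small_power_series:
  fixes \<gamma> :: "nat \<Rightarrow> real"
  assumes s: "(\<lambda>d. \<gamma> d * y ^ d) sums f" and y: "\<bar>y\<bar> \<le> 1" and r: "r \<ge> 2" and \<delta>: "\<delta> \<ge> 0"
    and low: "\<And>d. d < D \<Longrightarrow> \<bar>\<gamma> d\<bar> \<le> \<delta>" and high: "\<And>d. \<bar>\<gamma> d\<bar> \<le> \<delta> * r ^ D / r ^ d"
  shows "\<bar>f\<bar> \<le> (real D + 2) * \<delta>"
proof -
  have yd: "\<bar>y ^ d\<bar> \<le> 1" for d using y by (simp add: power_abs power_le_one)
  have f: "f = (\<Sum>d. \<gamma> (d + D) * y ^ (d + D)) + (\<Sum>d<D. \<gamma> d * y ^ d)"
    using suminf_split_initial_segment[OF sums_summable[OF s], of D] sums_unique[OF s] by simp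
  have geo: "(\<lambda>d. \<delta> * (1 / r) ^ d) sums (\<delta> * (1 / (1 - 1 / r)))"
    using r by (intro sums_mult geometric_sums) auto
  have tail: "norm (\<gamma> (d + D) * y ^ (d + D)) \<le> \<delta> * (1 / r) ^ d" for d
  proof -
    have "\<bar>\<gamma> (d + D)\<bar> * \<bar>y ^ (d + D)\<bar> \<le> \<bar>\<gamma> (d + D)\<bar> * 1" by (intro mult_left_mono yd) auto
    also have "\<dots> \<le> \<delta> * (1 / r) ^ d" using high[of "d + D"] r by (simp add: power_add power_one_over divide_simps)
    finally show ?thesis by (simp add: abs_mult)
  qed
  have "norm (\<Sum>d. \<gamma> (d + D) * y ^ (d + D)) \<le> (\<Sum>d. \<delta> * (1 / r) ^ d)"
  proof -
    have "summable (\<lambda>d. norm (\<gamma> (d + D) * y ^ (d + D)))"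
      using tail by (intro summable_comparison_test'[OF sums_summable[OF geo]]) auto
    then show ?thesis
      by (intro order_trans[OF summable_norm] suminf_le tail sums_summable[OF geo]) auto
  qed
  moreover have "(\<Sum>d. \<delta> * (1 / r) ^ d) = \<delta> * (1 / (1 - 1 / r))" using geo by (rule sums_unique[symmetric])
  moreover have "\<delta> * (1 / (1 - 1 / r)) \<le> \<delta> * 2"
    using r \<delta> by (intro mult_left_mono) (auto simp: divide_simps)
  moreover have "\<bar>\<Sum>d<D. \<gamma> d * y ^ d\<bar> \<le> (\<Sum>d<D. \<delta>)"
  proof (rule order_trans[OF sum_abs], rule sum_mono)
    fix d assume "d \<in> {..<D}"
    then have "\<bar>\<gamma> d\<bar> * \<bar>y ^ d\<bar> \<le> \<delta> * 1" by (intro mult_mono low yd \<delta>) auto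
    then show "\<bar>\<gamma> d * y ^ d\<bar> \<le> \<delta>" by (simp add: abs_mult)
  qed
  ultimately show ?thesis unfolding f by (simp add: algebra_simps)
qed

section \<open>Binomial polynomials and the auxiliary function\<close>

definition binomial_poly :: "nat \<Rightarrow> nat \<Rightarrow> real poly" where
  "binomial_poly B t = smult (1 / fact t) (\<Prod>j<t. [:real B - real j, 1:])"

lemma poly_binomial_poly: "poly (binomial_poly B t) x = (x + real B) gchoose t"
  by (simp add: binomial_poly_def poly_prod gbinomial_prod_rev atLeast0LessThan algebra_simps)

lemma poly_binomial_poly_int:
  "m + int B \<ge> 0 \<Longrightarrow> poly (binomial_poly B t) (of_int m) = real (nat (m + int B) choose t)"
  by (simp add: poly_binomial_poly binomial_gbinomial)

lemma degree_binomial_poly: "degree (binomial_poly B t) = t"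
proof -
  have "degree (\<Prod>j<t. [:real B - real j, 1:]) = (\<Sum>j<t. 1)"
    by (subst degree_prod_eq_sum_degree) auto
  then show ?thesis by (simp add: binomial_poly_def)
qed

text \<open>The shift by \<open>B\<close> serves two ends: the arguments \<open>m + B\<close> are
  natural numbers, so the values are integers, and for \<open>t \<le> B\<close> all linear factors
  have nonnegative constant terms, as the Cauchy estimate demands.\<close>

lemma coeff_binomial_poly_nonneg:
  assumes "t \<le> B" shows "coeff (binomial_poly B t) i \<ge> 0"
proof -
  have "coeff (\<Prod>j<t. [:real B - real j, 1:]) i \<ge> 0" using assms
  proof (induction t arbitrary: i)
    case 0
    then show ?case by (simp add: coeff_1)
  next
    case (Suc t)
    then show ?case by (cases i) (auto simp: mult.commute[of _ "[:_, _:]"] )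
  qed
  then show ?thesis by (simp add: binomial_poly_def)
qed

text \<open>A single term of \<open>(1 + x) ^ (2 * B) \<le> exp (2 * B * x)\<close> at
  \<open>x = T / (4 * B)\<close>, which leaves a factor independent of \<open>t\<close>.\<close>

lemma binomial_le_exp:
  fixes B T t :: nat
  assumes "B > 0" "T > 0"
  shows "real (2 * B choose t) \<le> exp (real T / 2) * (4 * real B / real T) ^ t"
proof (cases "t \<le> 2 * B")
  case True
  define x where "x = real T / (4 * real B)"
  have x: "x > 0" using assms by (simp add: x_def)
  have "real (2 * B choose t) * x ^ t \<le> (\<Sum>k\<le>2 * B. real (2 * B choose k) * x ^ k)"
    using True x by (intro member_le_sum) auto
  also have "\<dots> = (x + 1) ^ (2 * B)" by (simp add: binomial_ring)
  also have "\<dots> \<le> exp x ^ (2 * B)"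
    using x by (intro power_mono) (auto simp: add.commute)
  also have "\<dots> = exp (real T / 2)"
    using assms by (simp add: exp_of_nat_mult[symmetric] x_def)
  finally have "real (2 * B choose t) \<le> exp (real T / 2) / x ^ t" using x by (simp add: field_simps)
  also have "\<dots> = exp (real T / 2) * (4 * real B / real T) ^ t"
    using assms by (simp add: x_def power_divide)
  finally show ?thesis .
qed (simp add: binomial_eq_0)

text \<open>The heights decrease like \<open>x ^ t\<close> with \<open>x = T / (4 * B * r)\<close>.
  This cancels the growth of the \<open>t\<close>-th binomial on the circle of radius
  \<open>r\<close>, so all pairs \<open>(t, s)\<close> get the same bound. Assumption
  \<open>count\<close> is the logarithm of the comparison between the boxes and the coefficient
  vectors. The frequencies are centred at \<open>(S - 1) / 2\<close>, which makes the rescaled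
  exponents at most \<open>Y\<close> in modulus.\<close>

lemma auxiliary_coefficients:
  fixes B T S D :: nat and v H r Y :: real
  assumes T: "T > 0" and S: "S > 0" and TB: "T \<le> B" and v: "v \<ge> 0" and r: "r \<ge> 2" and H: "H > 0"
    and Y: "Y = (real S - 1) / 2 * v * real B"
    and count: "real D * ln 2 + real D * (real D + 1) / 2 * ln r
        + real S * (real T * (real T - 1) / 2) * ln (4 * real B * r / real T) \<le> real (S * T) * ln H"
  obtains c :: "nat \<Rightarrow> nat \<Rightarrow> int" where
    "\<exists>t<T. \<exists>s<S. c t s \<noteq> 0"
    "\<And>t s. t < T \<Longrightarrow> s < S \<Longrightarrow> \<bar>of_int (c t s)\<bar> \<le> H * (real T / (4 * real B * r)) ^ t"
    "\<And>m. \<bar>m\<bar> \<le> int B \<Longrightarrow>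
      \<bar>\<Sum>t<T. \<Sum>s<S. of_int (c t s) * real (nat (m + int B) choose t) * exp ((real s - (real S - 1) / 2) * v * of_int m)\<bar>
        \<le> (real D + 2) * (real (S * T) * H * exp (real T / 2 + r * Y) / r ^ D)"
proof -
  have B: "B > 0" using T TB by simp
  define I where "I = {..<T} \<times> {..<S}"
  define x where "x = real T / (4 * real B * r)"
  have x: "x > 0" using T B r by (simp add: x_def)
  define h :: "nat \<times> nat \<Rightarrow> nat" where "h = (\<lambda>(t, s). nat \<lfloor>H * x ^ t\<rfloor>)"
  define \<alpha> :: "nat \<times> nat \<Rightarrow> real" where "\<alpha> = (\<lambda>(t, s). (real s - (real S - 1) / 2) * v * real B)"
  define A where "A d i = exp_poly_coeff (binomial_poly B (fst i)) (real B) (\<alpha> i) d" for d i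
  define \<delta> where "\<delta> = real (S * T) * H * exp (real T / 2 + r * Y) / r ^ D"
  \<comment> \<open>The coefficient of order \<open>d\<close> is at most
    \<open>\<delta> * r ^ (D - d)\<close>, so about \<open>r ^ (D - d)\<close> boxes of width
    \<open>\<delta>\<close> suffice. Their product produces the exponent
    \<open>D * (D + 1) / 2\<close>.\<close>
  define g where "g d = nat \<lfloor>r ^ (D - d)\<rfloor>" for d
  have \<delta>: "\<delta> > 0" using S T H r by (simp add: \<delta>_def)
  have cardI: "card I = S * T" by (simp add: I_def)
  have Abound: "H * x ^ t * \<bar>A d (t, s)\<bar> \<le> H * exp (real T / 2 + r * Y) / r ^ d" if ts: "t < T" "s < S" for t s d
  proof -
    have a: "\<bar>\<alpha> (t, s)\<bar> \<le> Y"
    proof -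
      have "\<bar>real s - (real S - 1) / 2\<bar> \<le> (real S - 1) / 2" using ts by (simp add: abs_if field_simps; linarith)
      then have "\<bar>real s - (real S - 1) / 2\<bar> * (v * real B) \<le> (real S - 1) / 2 * (v * real B)"
        using v by (intro mult_right_mono) auto
      then show ?thesis using v by (simp add: \<alpha>_def Y abs_mult mult.assoc)
    qed
    have "\<bar>A d (t, s)\<bar> \<le> poly (binomial_poly B t) (real B) * r ^ t * exp (r * Y) / r ^ d"
      unfolding A_def fst_conv
      by (rule exp_poly_coeff_bound) (use ts TB r a in \<open>auto simp: degree_binomial_poly intro: coeff_binomial_poly_nonneg\<close>)
    also have "poly (binomial_poly B t) (real B) = real (2 * B choose t)"
      proof -
      have "nat (int B + int B) = 2 * B" by simp
      then show ?thesis using poly_binomial_poly_int[of "int B" B t] by simp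
    qed
    also have "real (2 * B choose t) * r ^ t * exp (r * Y) / r ^ d
        \<le> (exp (real T / 2) * (4 * real B / real T) ^ t) * r ^ t * exp (r * Y) / r ^ d"
      using r by (intro divide_right_mono mult_right_mono binomial_le_exp B T) auto
    finally have "H * x ^ t * \<bar>A d (t, s)\<bar> \<le> H * x ^ t * ((exp (real T / 2) * (4 * real B / real T) ^ t) * r ^ t * exp (r * Y) / r ^ d)"
      using H x by (intro mult_left_mono) auto
    also have "\<dots> = (x * (4 * real B / real T) * r) ^ t * (H * exp (real T / 2 + r * Y) / r ^ d)"
      unfolding power_mult_distrib exp_add by (simp add: mult_ac)
    also have "x * (4 * real B / real T) * r = 1" using T B r by (simp add: x_def)
    finally show ?thesis by simp
  qed
  have sumbound: "(\<Sum>i\<in>I. H * x ^ fst i * \<bar>A d i\<bar>) \<le> \<delta> * r ^ D / r ^ d" for d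
  proof -
    have "(\<Sum>i\<in>I. H * x ^ fst i * \<bar>A d i\<bar>) \<le> (\<Sum>i\<in>I. H * exp (real T / 2 + r * Y) / r ^ d)"
      by (intro sum_mono) (auto simp: I_def intro: Abound)
    also have "\<dots> = \<delta> * r ^ D / r ^ d" using r by (simp add: cardI \<delta>_def)
    finally show ?thesis .
  qed
  have hle: "real (h i) \<le> H * x ^ fst i" for i
    using H x by (cases i) (auto simp: h_def)
  have 1: "(\<Sum>i\<in>I. real (h i) * \<bar>A d i\<bar>) < \<delta> * (real (g d) + 1)" if d: "d < D" for d
  proof -
    have "(\<Sum>i\<in>I. real (h i) * \<bar>A d i\<bar>) \<le> (\<Sum>i\<in>I. H * x ^ fst i * \<bar>A d i\<bar>)"
      by (intro sum_mono mult_right_mono hle) auto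
    also have "\<dots> \<le> \<delta> * r ^ D / r ^ d" by (rule sumbound)
    also have "\<dots> = \<delta> * r ^ (D - d)" using d r by (simp add: power_diff)
    also have "\<dots> < \<delta> * (real (g d) + 1)"
    proof (rule mult_strict_left_mono[OF _ \<delta>])
      have "0 \<le> \<lfloor>r ^ (D - d)\<rfloor>" using r by simp
      then show "r ^ (D - d) < real (g d) + 1" unfolding g_def by simp
    qed
    finally show ?thesis .
  qed
  have 2: "(\<Prod>d<D. g d + 1) < (\<Prod>i\<in>I. h i + 1)"
  proof -
    have "real (\<Prod>d<D. g d + 1) = (\<Prod>d<D. real (g d) + 1)" by (simp add: add.commute)
    also have "\<dots> \<le> (\<Prod>d<D. 2 * r ^ (D - d))"
    proof (rule prod_mono)
      fix d
      have "real (g d) \<le> r ^ (D - d)" using r by (simp add: g_def)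
      moreover have "1 \<le> r ^ (D - d)" using r by simp
      ultimately show "0 \<le> real (g d) + 1 \<and> real (g d) + 1 \<le> 2 * r ^ (D - d)" by linarith
    qed
    also have "\<dots> = 2 ^ D * (\<Prod>d<D. r ^ (Suc d))"
    proof -
      have "(\<Prod>d<D. r ^ (D - d)) = (\<Prod>d<D. r ^ (Suc d))"
        by (subst prod.nat_diff_reindex[symmetric]) (intro prod.cong, auto simp: Suc_diff_Suc)
      then show ?thesis by (simp add: prod.distrib)
    qed
    also have "(\<Prod>d<D. r ^ (Suc d)) = exp (real D * (real D + 1) / 2 * ln r)"
    proof (induction D)
      case (Suc D)
      have "r ^ Suc D = exp (real (Suc D) * ln r)" using r by (simp only: exp_of_nat_mult exp_ln)
      then show ?case using Suc by (simp add: exp_add[symmetric] field_simps)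
    qed simp
    also have "2 ^ D = exp (real D * ln 2)" by (simp add: exp_of_nat_mult)
    also have "exp (real D * ln 2) * exp (real D * (real D + 1) / 2 * ln r)
      \<le> exp (real (S * T) * ln H - real S * (real T * (real T - 1) / 2) * ln (4 * real B * r / real T))"
      using count by (simp add: exp_add[symmetric])
    also have "\<dots> = (\<Prod>i\<in>I. H * x ^ fst i)"
    proof -
      have "(\<Prod>i\<in>I. H * x ^ fst i) = (\<Prod>t<T. \<Prod>s<S. H * x ^ t)"
        unfolding I_def prod.cartesian_product by (simp add: case_prod_beta)
      also have "\<dots> = (\<Prod>t<T. exp (real S * ln H + real t * (real S * ln x)))"
      proof (rule prod.cong)
        fix t
        have "H * x ^ t = exp (ln H + real t * ln x)" using H x by (simp add: exp_add exp_of_nat_mult)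
        then have "(H * x ^ t) ^ S = exp (real S * (ln H + real t * ln x))"
          by (simp only: exp_of_nat_mult)
        then show "(\<Prod>s<S. H * x ^ t) = exp (real S * ln H + real t * (real S * ln x))"
          by (simp add: algebra_simps)
      qed simp
      also have "\<dots> = exp (\<Sum>t<T. real S * ln H + real t * (real S * ln x))" by (simp add: exp_sum)
      also have "(\<Sum>t<T. real S * ln H + real t * (real S * ln x)) = real T * real S * ln H + real T * (real T - 1) / 2 * (real S * ln x)"
      proof -
        have "(\<Sum>t<T. real t) = real T * (real T - 1) / 2"
          by (induction T) (auto simp: field_simps)
        then show ?thesis by (simp add: sum.distrib sum_distrib_right[symmetric])
      qed
      also have "ln x = - ln (4 * real B * r / real T)"
        using T B r by (simp add: x_def ln_div)
      finally show ?thesis by (simp add: algebra_simps)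
    qed
    \<comment> \<open>Even where \<open>H * x ^ t\<close> is below 1 and the height is 0, it is
      exceeded by \<open>h i + 1\<close>; rounding costs nothing.\<close>
    also have "\<dots> < (\<Prod>i\<in>I. real (h i) + 1)"
    proof (rule prod_mono_strict)
      show "(0, 0) \<in> I" using S T by (simp add: I_def)
      have *: "H * x ^ fst i < real (h i) + 1" for i
      proof -
        have "0 \<le> \<lfloor>H * x ^ fst i\<rfloor>" using H x by simp
        then show ?thesis by (simp add: h_def case_prod_beta)
      qed
      then show "H * x ^ fst (0::nat, 0::nat) < real (h (0, 0)) + 1" by blast
      show "\<And>i. i \<in> I \<Longrightarrow> 0 \<le> H * x ^ fst i \<and> H * x ^ fst i \<le> real (h i) + 1"
        using * H x by (auto intro: less_imp_le)
      show "\<And>i. i \<in> I \<Longrightarrow> 0 < real (h i) + 1" by (simp add: add_nonneg_pos)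
    qed (auto simp: I_def)
    also have "\<dots> = real (\<Prod>i\<in>I. h i + 1)" by (simp add: add.commute)
    finally show ?thesis by linarith
  qed
  obtain c :: "nat \<times> nat \<Rightarrow> int" where c: "\<exists>i\<in>I. c i \<noteq> 0" "\<And>i. i \<in> I \<Longrightarrow> \<bar>c i\<bar> \<le> int (h i)"
    "\<And>d. d < D \<Longrightarrow> \<bar>\<Sum>i\<in>I. of_int (c i) * A d i\<bar> \<le> \<delta>"
    using small_linear_forms[of I \<delta> D h A g] \<delta> 1 2 by (auto simp: I_def)
  have cle: "\<bar>real_of_int (c i)\<bar> \<le> H * x ^ fst i" if "i \<in> I" for i
    using c(2)[OF that] hle[of i] by linarith
  show ?thesis
  proof (rule that[of "\<lambda>t s. c (t, s)"])
    show "\<exists>t<T. \<exists>s<S. c (t, s) \<noteq> 0" using c(1) by (auto simp: I_def)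
    show "\<bar>real_of_int (c (t, s))\<bar> \<le> H * (real T / (4 * real B * r)) ^ t" if "t < T" "s < S" for t s
      using cle[of "(t, s)"] that by (simp add: I_def x_def)
    fix m :: int assume m: "\<bar>m\<bar> \<le> int B"
    define y where "y = of_int m / real B"
    have y: "\<bar>y\<bar> \<le> 1" using m B by (simp add: y_def abs_div)
    have By: "real B * y = of_int m" using B by (simp add: y_def)
    have "(\<lambda>d. \<Sum>i\<in>I. of_int (c i) * (A d i * y ^ d)) sums
        (\<Sum>i\<in>I. of_int (c i) * (poly (binomial_poly B (fst i)) (real B * y) * exp (\<alpha> i * y)))"
      unfolding A_def by (intro sums_sum sums_mult exp_poly_coeff_sums)
    then have s: "(\<lambda>d. (\<Sum>i\<in>I. of_int (c i) * A d i) * y ^ d) sums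
        (\<Sum>i\<in>I. of_int (c i) * (poly (binomial_poly B (fst i)) (of_int m) * exp (\<alpha> i * y)))"
      by (simp add: By sum_distrib_right mult.assoc)
    have "\<bar>\<Sum>i\<in>I. of_int (c i) * (poly (binomial_poly B (fst i)) (of_int m) * exp (\<alpha> i * y))\<bar> \<le> (real D + 2) * \<delta>"
    proof (rule small_power_series[OF s y r])
      fix d
      have "\<bar>\<Sum>i\<in>I. of_int (c i) * A d i\<bar> \<le> (\<Sum>i\<in>I. H * x ^ fst i * \<bar>A d i\<bar>)"
        by (rule order_trans[OF sum_abs], rule sum_mono) (auto simp: abs_mult intro!: mult_right_mono cle)
      also have "\<dots> \<le> \<delta> * r ^ D / r ^ d" by (rule sumbound)
      finally show "\<bar>\<Sum>i\<in>I. of_int (c i) * A d i\<bar> \<le> \<delta> * r ^ D / r ^ d" .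
    qed (use \<delta> c(3) in auto)
    also have "(\<Sum>i\<in>I. of_int (c i) * (poly (binomial_poly B (fst i)) (of_int m) * exp (\<alpha> i * y))) =
      (\<Sum>t<T. \<Sum>s<S. of_int (c (t, s)) * real (nat (m + int B) choose t) * exp ((real s - (real S - 1) / 2) * v * of_int m))"
      using m B by (simp add: I_def sum.cartesian_product case_prod_beta poly_binomial_poly_int \<alpha>_def mult.assoc By)
    finally show "\<bar>\<Sum>t<T. \<Sum>s<S. of_int (c (t, s)) * real (nat (m + int B) choose t) * exp ((real s - (real S - 1) / 2) * v * of_int m)\<bar>
        \<le> (real D + 2) * (real (S * T) * H * exp (real T / 2 + r * Y) / r ^ D)" unfolding \<delta>_def .
  qed
qed

section \<open>Contradiction from a good approximation\<close>

text \<open>This controls the exchange of the root for \<open>w\<close> in the exponentials. The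
  factor 2 pays for the quadratic term of \<open>exp\<close> and for negative exponents.\<close>

lemma power_int_near_one:
  fixes x \<epsilon> :: real and j :: int
  assumes x: "\<bar>x - 1\<bar> \<le> \<epsilon>" and j: "\<bar>j\<bar> \<le> int k" and k: "2 * real k * \<epsilon> \<le> 1"
  shows "\<bar>x powi j - 1\<bar> \<le> 2 * real k * \<epsilon>"
proof -
  define i where "i = nat \<bar>j\<bar>"
  define e where "e = real i * \<epsilon>"
  have \<epsilon>: "\<epsilon> \<ge> 0" using x by linarith
  have ik: "e \<le> real k * \<epsilon>" using j \<epsilon> unfolding e_def i_def by (intro mult_right_mono) auto
  have e: "0 \<le> e" "e \<le> 1 / 2" using \<epsilon> ik k by (auto simp: e_def)
  show ?thesis
  proof (cases "i = 0")
    case True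
    then show ?thesis using \<epsilon> by (simp add: i_def)
  next
    case False
    have "\<epsilon> \<le> e" using False \<epsilon> mult_right_mono[of 1 "real i" \<epsilon>] unfolding e_def by simp
    then have x12: "x \<ge> 1 / 2" "\<epsilon> \<le> 1 / 2" using x e by linarith+
    have up: "x ^ i \<le> 1 + e + e\<^sup>2"
    proof -
      have "x ^ i \<le> exp \<epsilon> ^ i"
        using x x12 exp_ge_add_one_self[of \<epsilon>] by (intro power_mono) linarith+
      also have "\<dots> = exp e" by (simp add: e_def exp_of_nat_mult)
      also have "\<dots> \<le> 1 + e + e\<^sup>2" using e by (intro exp_bound) auto
      finally show ?thesis .
    qed
    have lo: "x ^ i \<ge> 1 - e"
    proof -
      have "1 - e \<le> (1 + (- \<epsilon>)) ^ i" using Bernoulli_inequality[of "- \<epsilon>" i] x12 by (simp add: e_def)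
      also have "\<dots> \<le> x ^ i" using x x12 by (intro power_mono) linarith+
      finally show ?thesis .
    qed
    have e2: "e\<^sup>2 \<le> e" using e by (simp add: power2_eq_square mult_left_le)
    have "\<bar>x powi j - 1\<bar> \<le> 2 * e"
    proof (cases "j \<ge> 0")
      case True
      then have "x powi j = x ^ i" by (simp add: i_def power_int_def)
      then show ?thesis using up lo e2 e by linarith
    next
      case False
      then have eq: "x powi j = 1 / x ^ i" by (simp add: i_def power_int_def divide_inverse power_inverse)
      have pos: "x ^ i > 0" using x12 by simp
      have "1 / x ^ i \<le> 1 + 2 * e"
      proof -
        have "1 \<le> (1 + 2 * e) * (1 - e)" using e mult_left_mono[of e "1/2" "2 * e"] by (simp add: algebra_simps)
        also have "\<dots> \<le> (1 + 2 * e) * x ^ i" using lo e by (intro mult_left_mono) auto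
        finally show ?thesis using pos by (simp add: field_simps)
      qed
      moreover have "1 / x ^ i \<ge> 1 - 2 * e"
      proof -
        have "(1 - 2 * e) * x ^ i \<le> (1 - 2 * e) * (1 + 2 * e)" using up e2 e by (intro mult_left_mono) auto
        also have "\<dots> \<le> 1" by (simp add: algebra_simps)
        finally show ?thesis using pos by (simp only: pos_le_divide_eq)
      qed
      ultimately show ?thesis unfolding eq by linarith
    qed
    then show ?thesis using ik by linarith
  qed
qed

section \<open>Lattice points of the diamond\<close>

definition diamond :: "nat \<Rightarrow> nat \<Rightarrow> (int \<times> int) set" where
  "diamond M L = {(k, l). \<bar>l\<bar> < int L \<and> \<bar>k\<bar> \<le> int M * (int L - \<bar>l\<bar>)}"

lemma sum_triangle: "(\<Sum>l\<in>{- int L<..<int L}. int L - \<bar>l\<bar>) = (int L)\<^sup>2"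
proof (induction L)
  case (Suc L)
  show ?case
  proof (cases "L = 0")
    case True
    have "{- 1<..<1::int} = {0}" by auto
    then show ?thesis using True by simp
  next
    case False
    have "{- int (Suc L)<..<int (Suc L)} = insert (int L) (insert (- int L) {- int L<..<int L})"
      using False by auto
    then have "(\<Sum>l\<in>{- int (Suc L)<..<int (Suc L)}. int (Suc L) - \<bar>l\<bar>) =
      2 + (\<Sum>l\<in>{- int L<..<int L}. (int L - \<bar>l\<bar>) + 1)"
      using False by (simp add: algebra_simps)
    also have "\<dots> = 2 + (\<Sum>l\<in>{- int L<..<int L}. int L - \<bar>l\<bar>) + (\<Sum>l\<in>{- int L<..<int L}. 1)"
      by (simp only: sum.distrib add.assoc)
    also have "\<dots> = (int (Suc L))\<^sup>2" using Suc False by (simp add: power2_eq_square algebra_simps)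
    finally show ?thesis .
  qed
qed simp

lemma diamond_eq: "diamond M L = (\<lambda>(l, k). (k, l)) `
   (SIGMA l:{- int L<..<int L}. {- (int M * (int L - \<bar>l\<bar>))..int M * (int L - \<bar>l\<bar>)})"
  by (auto simp: diamond_def image_iff)

lemma finite_diamond: "finite (diamond M L)"
  unfolding diamond_eq by (intro finite_imageI finite_SigmaI) auto

text \<open>Row \<open>l\<close> has \<open>2 * M * (L - \<bar>l\<bar>) + 1\<close> points; dropping
  the ones leaves exactly \<open>S * T\<close> points for \<open>M = S * j\<close> and
  \<open>T = 2 * j * L\<^sup>2\<close>, which is the reason for this choice.\<close>

lemma card_diamond_ge: "2 * M * L\<^sup>2 \<le> card (diamond M L)"
proof -
  have "int (card (diamond M L)) =
      int (card (SIGMA l:{- int L<..<int L}. {- (int M * (int L - \<bar>l\<bar>))..int M * (int L - \<bar>l\<bar>)}))"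
    unfolding diamond_eq by (subst card_image) (auto simp: inj_on_def)
  also have "\<dots> = (\<Sum>l\<in>{- int L<..<int L}. int (nat (2 * (int M * (int L - \<bar>l\<bar>)) + 1)))"
    by (subst card_SigmaI) (auto simp: algebra_simps)
  also have "\<dots> \<ge> (\<Sum>l\<in>{- int L<..<int L}. 2 * int M * (int L - \<bar>l\<bar>))"
    by (intro sum_mono) auto
  also have "(\<Sum>l\<in>{- int L<..<int L}. 2 * int M * (int L - \<bar>l\<bar>)) = 2 * int M * (int L)\<^sup>2"
    by (simp add: sum_distrib_left[symmetric] sum_triangle)
  finally have "int (2 * M * L\<^sup>2) \<le> int (card (diamond M L))" by simp
  then show ?thesis by (simp only: of_nat_le_iff)
qed

text \<open>Two values of \<open>l\<close> differ by less than \<open>2 * L \<le> n\<close>, so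
  \<open>n * k + l\<close> determines \<open>l\<close> through its residue modulo \<open>n\<close>.
  This is where \<open>n\<close> has to be large.\<close>

lemma inj_on_diamond:
  assumes "2 * L \<le> n"
  shows "inj_on (\<lambda>(k, l). real n * of_int k + of_int l :: real) (diamond M L)"
proof (rule inj_onI, clarify)
  fix k l k' l'
  assume d: "(k, l) \<in> diamond M L" "(k', l') \<in> diamond M L"
    and eq: "real n * of_int k + of_int l = real n * of_int k' + of_int l'"
  have "real_of_int (int n * k + l) = real_of_int (int n * k' + l')" using eq by simp
  then have eq: "int n * (k - k') = l' - l" by (simp only: of_int_eq_iff) (simp add: algebra_simps)
  have "\<bar>l' - l\<bar> < int n" using d assms by (auto simp: diamond_def)
  moreover have "\<bar>l' - l\<bar> = int n * \<bar>k - k'\<bar>" using eq by (metis abs_mult abs_of_nat)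
  ultimately have "k = k'"
    by (smt (verit) mult_less_cancel_left2 of_nat_less_0_iff)
  then show "k = k' \<and> l = l'" using eq by simp
qed

text \<open>Assumption \<open>aq\<close> gives
  \<open>a ^ \<bar>k\<bar> * q ^ \<bar>l\<bar> \<le> q ^ L\<close> on the diamond, so all its points
  have denominators of comparable size. \<open>close\<close> keeps the cost of exchanging the root
  for \<open>w\<close> within the analytic bound, and \<open>small\<close> says that this bound
  times the denominator is below 1. The factors \<open>a ^ S\<close> and \<open>4 ^ L\<close> pay
  for the shifts of \<open>k\<close> in the zero estimate and for the difference between
  \<open>p\<close> and \<open>q\<close>.\<close>

lemma no_good_approximation:
  fixes a b n p q S L j D :: nat and v w H r Y \<epsilon> :: real
  defines "M \<equiv> S * j" and "T \<equiv> 2 * j * L\<^sup>2"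
  defines "B \<equiv> n * (M * L + S) + L"
  assumes b: "b > 0" and ab: "b < a" "a \<le> 2 * b" and S: "S > 0" and L: "L > 0" and j: "j > 0"
    and n: "2 * L \<le> n" and p: "p > 0" and q: "q > 0" and pq: "p \<le> 2 * q" and aq: "a ^ M \<le> q"
    and v: "v = ln (real a / real b) / real n" and w: "w = real p / real q"
    and \<epsilon>: "\<bar>w / exp v - 1\<bar> \<le> \<epsilon>" "2 * real (L * S) * \<epsilon> \<le> 1"
    and r: "r \<ge> 2" and H: "H > 0"
    and Y: "Y = (real S - 1) / 2 * v * real B"
    and count: "real D * ln 2 + real D * (real D + 1) / 2 * ln r
        + real S * (real T * (real T - 1) / 2) * ln (4 * real B * r / real T) \<le> real (S * T) * ln H"
    and close: "2 * real (L * S) * \<epsilon> * exp Y \<le> exp (r * Y) / r ^ D"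
    and small: "(real D + 3) * (real (S * T) * H * exp (real T / 2 + r * Y) / r ^ D)
        * (real q ^ L * real a ^ S * 4 ^ L) ^ (S - 1) < 1"
  shows False
proof -
  define z where "z = real a / real b"
  define h where "h = (real S - 1) / 2"
  have z: "z > 1" "z \<le> 2" using b ab by (auto simp: z_def field_simps)
  have w0: "w > 0" using p q w by simp
  have n0: "n > 0" using n L by simp
  have v0: "v > 0" using z n0 by (simp add: v z_def[symmetric])
  have T: "T > 0" using j L by (simp add: T_def)
  have vn: "exp (v * real n) = z" using n0 z by (simp add: v z_def[symmetric])
  have ev2: "exp v \<le> 2"
  proof -
    have "v \<le> v * real n" using n0 v0 by simp
    then have "exp v \<le> exp (v * real n)" by simp
    then show ?thesis using vn z by linarith
  qed
  have TB: "T \<le> B"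
  proof -
    have "j * 1 * (2 * L * L) \<le> j * S * (n * L)" using n S by (intro mult_mono) auto
    then have "T \<le> n * (M * L)" by (simp add: T_def M_def power2_eq_square mult_ac)
    then show ?thesis by (simp add: B_def algebra_simps)
  qed
  define \<delta> where "\<delta> = real (S * T) * H * exp (real T / 2 + r * Y) / r ^ D"
  obtain c :: "nat \<Rightarrow> nat \<Rightarrow> int" where c: "\<exists>t<T. \<exists>s<S. c t s \<noteq> 0"
    "\<And>t s. t < T \<Longrightarrow> s < S \<Longrightarrow> \<bar>of_int (c t s)\<bar> \<le> H * (real T / (4 * real B * r)) ^ t"
    "\<And>m. \<bar>m\<bar> \<le> int B \<Longrightarrow>
      \<bar>\<Sum>t<T. \<Sum>s<S. of_int (c t s) * real (nat (m + int B) choose t) * exp ((real s - h) * v * of_int m)\<bar>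
        \<le> (real D + 2) * \<delta>"
    using auxiliary_coefficients[OF T S TB less_imp_le[OF v0] r H Y count] unfolding \<delta>_def h_def by blast
  define Q where "Q s = (\<Sum>t<T. smult (of_int (c t s)) (binomial_poly B t))" for s
  have degQ: "degree (Q s) < T" for s
    unfolding Q_def using T by (intro degree_sum_less) (auto simp: degree_binomial_poly intro: le_less_trans[OF degree_smult_le])
  have nzQ: "\<exists>s<S. Q s \<noteq> 0"
  proof -
    obtain t0 s where ts: "t0 < T" "s < S" "c t0 s \<noteq> 0" using c(1) by blast
    \<comment> \<open>Binomials of lower index have degree below \<open>t\<close>, so the
      contribution of the largest index with a nonzero coefficient cannot cancel.\<close>
    define t where "t = Max {t. t < T \<and> c t s \<noteq> 0}"
    have fin: "finite {t. t < T \<and> c t s \<noteq> 0}" by simp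
    have "t \<in> {t. t < T \<and> c t s \<noteq> 0}" unfolding t_def using ts by (intro Max_in) auto
    then have t: "t < T" "c t s \<noteq> 0" by auto
    have tmax: "c t' s = 0" if "t' < T" "t < t'" for t'
      using Max_ge[OF fin, of t'] that unfolding t_def by fastforce
    have "coeff (Q s) t = (\<Sum>t'<T. of_int (c t' s) * coeff (binomial_poly B t') t)"
      by (simp add: Q_def coeff_sum)
    also have "\<dots> = (\<Sum>t'\<in>{t}. of_int (c t' s) * coeff (binomial_poly B t') t)"
    proof (rule sum.mono_neutral_right)
      show "\<forall>t'\<in>{..<T} - {t}. of_int (c t' s) * coeff (binomial_poly B t') t = 0"
      proof
        fix t' assume t': "t' \<in> {..<T} - {t}"
        show "of_int (c t' s) * coeff (binomial_poly B t') t = 0"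
          using t' tmax[of t'] coeff_eq_0[of "binomial_poly B t'" t]
          by (cases "t < t'") (auto simp: degree_binomial_poly)
      qed
    qed (use t in auto)
    also have "\<dots> \<noteq> 0"
    proof -
      have "binomial_poly B t \<noteq> 0" by (simp add: binomial_poly_def)
      then show ?thesis using t leading_coeff_0_iff[of "binomial_poly B t"] by (simp add: degree_binomial_poly)
    qed
    finally show ?thesis using ts(2) by auto
  qed
  have big: "(T - 1) * S < card (diamond M L)"
  proof -
    have "(T - 1) * S < T * S" using T S by simp
    also have "\<dots> = 2 * M * L\<^sup>2" by (simp add: T_def M_def)
    also have "\<dots> \<le> card (diamond M L)" by (rule card_diamond_ge)
    finally show ?thesis .
  qed
  obtain k0 l i where kl0: "(k0, l) \<in> diamond M L" "i < S"
    and nonzero: "(\<Sum>s<S. poly (Q s) (real n * of_int (k0 + int i) + of_int l) *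
           (z powi (k0 + int i) * w powi l) ^ s) \<noteq> 0"
    using exp_poly_zero_estimate[OF z(1) w0 degQ nzQ inj_on_diamond[OF n] finite_diamond big] by blast
  define k where "k = k0 + int i"
  define m where "m = int n * k + l"
  have l: "\<bar>l\<bar> < int L" and k: "\<bar>k\<bar> \<le> int M * (int L - \<bar>l\<bar>) + int S"
    using kl0 by (auto simp: diamond_def k_def)
  have mB: "\<bar>m\<bar> \<le> int B"
  proof -
    have "\<bar>k\<bar> \<le> int M * int L + int S" using k mult_left_mono[of "int L - \<bar>l\<bar>" "int L" "int M"] by simp
    then have "int n * \<bar>k\<bar> \<le> int n * (int M * int L + int S)" by (intro mult_left_mono) auto
    moreover have "\<bar>m\<bar> \<le> int n * \<bar>k\<bar> + \<bar>l\<bar>" unfolding m_def using abs_triangle_ineq[of "int n * k" l] by (simp add: abs_mult)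
    ultimately show ?thesis using l by (simp add: B_def)
  qed
  define C where "C t = (nat (m + int B) choose t)" for t
  define g where "g = z powi k * w powi l"
  define \<Phi> where "\<Phi> = (\<Sum>t<T. \<Sum>s<S. of_int (c t s) * real (C t) * g ^ s)"
  have \<Phi>0: "\<Phi> \<noteq> 0"
  proof -
    have "poly (Q s) (real n * of_int k + of_int l) = (\<Sum>t<T. of_int (c t s) * real (C t))" for s
    proof -
      have "real n * of_int k + of_int l = of_int m" by (simp add: m_def)
      then show ?thesis using mB by (simp add: Q_def poly_sum C_def poly_binomial_poly_int)
    qed
    then have "(\<Sum>s<S. (\<Sum>t<T. of_int (c t s) * real (C t)) * g ^ s) \<noteq> 0"
      using nonzero by (simp add: k_def[symmetric] g_def)
    then show ?thesis by (subst (asm) sum_distrib_right, subst (asm) sum.swap) (simp add: \<Phi>_def)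
  qed
  \<comment> \<open>The square root of \<open>z^k \<xi>^l\<close> with \<open>\<xi> = exp v\<close>.
    The centring factor is \<open>E\<close> to the power \<open>- (S - 1)\<close>, and
    \<open>E\<close> times the denominator of \<open>g\<close> is nearly the geometric mean of
    numerator and denominator, which is bounded alike for both signs of \<open>k\<close> and
    \<open>l\<close>.\<close>
  define E where "E = exp (v * of_int m / 2)"
  have E2: "E\<^sup>2 = z powi k * exp v powi l"
  proof -
    have "E\<^sup>2 = exp (v * of_int m)" by (simp add: E_def power2_eq_square exp_add[symmetric])
    also have "\<dots> = exp (v * real n * of_int k) * exp (v * of_int l)"
      by (simp add: m_def exp_add[symmetric] algebra_simps)
    also have "\<dots> = exp (v * real n) powi k * exp v powi l"
      by (simp add: exp_power_int mult.commute)
    finally show ?thesis by (simp add: vn)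
  qed
  define x1 y1 where "x1 = (if k \<ge> 0 then a ^ nat k else b ^ nat (- k))"
    and "y1 = (if k \<ge> 0 then b ^ nat k else a ^ nat (- k))"
  define x2 y2 where "x2 = (if l \<ge> 0 then p ^ nat l else q ^ nat (- l))"
    and "y2 = (if l \<ge> 0 then q ^ nat l else p ^ nat (- l))"
  have zk: "z powi k = real x1 / real y1"
    by (simp add: z_def x1_def y1_def power_int_def power_divide)
  have wl: "w powi l = real x2 / real y2"
    by (simp add: w x2_def y2_def power_int_def power_divide)
  define y where "y = y1 * y2"
  have y12: "y1 > 0" "y2 > 0" using b ab p q by (auto simp: y1_def y2_def)
  have y0: "y > 0" using y12 by (simp add: y_def)
  have g: "g = real (x1 * x2) / real y" by (simp add: g_def zk wl y_def)
  have lower: "1 \<le> \<bar>\<Phi>\<bar> * real y ^ (S - 1)"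
  proof -
    have "\<Phi> * real y ^ (S - 1) = (\<Sum>t<T. \<Sum>s<S. of_int (c t s) * real (C t) * (g ^ s * real y ^ (S - 1)))"
      by (simp add: \<Phi>_def sum_distrib_right mult.assoc)
    also have "\<dots> = (\<Sum>t<T. \<Sum>s<S. of_int (c t s) * real (C t) * (real (x1 * x2) ^ s * real y ^ (S - 1 - s)))"
    proof (rule sum.cong[OF refl], rule sum.cong[OF refl], rule arg_cong[where f="(*) _"])
      fix s assume "s \<in> {..<S}"
      then have "real y ^ (S - 1) = real y ^ s * real y ^ (S - 1 - s)" by (simp flip: power_add)
      then show "g ^ s * real y ^ (S - 1) = real (x1 * x2) ^ s * real y ^ (S - 1 - s)"
        using y0 by (simp add: g power_divide)
    qed
    also have "\<dots> = of_int (\<Sum>t<T. \<Sum>s<S. c t s * int (C t) * (int (x1 * x2) ^ s * int y ^ (S - 1 - s)))"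
      by simp
    finally have "\<Phi> * real y ^ (S - 1) \<in> \<int>" by (simp only: Ints_of_int)
    moreover have "\<Phi> * real y ^ (S - 1) \<noteq> 0" using \<Phi>0 y0 by simp
    ultimately have "1 \<le> \<bar>\<Phi> * real y ^ (S - 1)\<bar>" by (rule Ints_nonzero_abs_ge1)
    then show ?thesis by (simp add: abs_mult)
  qed
  have E0: "E > 0" by (simp add: E_def)
  define W where "W = real q ^ L * real a ^ S * 4 ^ L"
  have yE: "real y * E \<le> W"
  proof -
    \<comment> \<open>The left side is \<open>x1 * y1\<close>, that is
      \<open>(a * b) ^ \<bar>k\<bar>\<close>.\<close>
    have k1: "(real y1)\<^sup>2 * z powi k \<le> (real a ^ nat \<bar>k\<bar>)\<^sup>2"
    proof (cases "k \<ge> 0")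
      case True
      have "(real y1)\<^sup>2 * z powi k = real y1 * real x1" using y12 by (simp add: zk power2_eq_square)
      also have "\<dots> = real b ^ nat k * real a ^ nat k" using True by (simp add: x1_def y1_def)
      also have "\<dots> \<le> real a ^ nat k * real a ^ nat k" using ab by (intro mult_right_mono power_mono) auto
      finally show ?thesis using True by (simp add: power2_eq_square)
    next
      case False
      have "(real y1)\<^sup>2 * z powi k = real y1 * real x1" using y12 by (simp add: zk power2_eq_square)
      also have "\<dots> = real b ^ nat (- k) * real a ^ nat (- k)" using False by (simp add: x1_def y1_def)
      also have "\<dots> \<le> real a ^ nat (- k) * real a ^ nat (- k)" using ab by (intro mult_right_mono power_mono) auto
      finally show ?thesis using False by (simp add: power2_eq_square)
    qed
    have kq: "real a ^ nat \<bar>k\<bar> \<le> real q ^ nat (int L - \<bar>l\<bar>) * real a ^ S"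
    proof -
      have "nat \<bar>k\<bar> \<le> M * nat (int L - \<bar>l\<bar>) + S"
        unfolding nat_le_iff using k l by simp
      then have "real a ^ nat \<bar>k\<bar> \<le> real a ^ (M * nat (int L - \<bar>l\<bar>) + S)"
        using ab b by (intro power_increasing) auto
      also have "\<dots> = (real (a ^ M)) ^ nat (int L - \<bar>l\<bar>) * real a ^ S" by (simp add: power_add power_mult)
      also have "\<dots> \<le> real q ^ nat (int L - \<bar>l\<bar>) * real a ^ S"
        using aq of_nat_mono[OF aq, where 'a=real] by (intro mult_right_mono power_mono) auto
      finally show ?thesis .
    qed
    have l1: "(real y2)\<^sup>2 * exp v powi l \<le> (real q ^ nat \<bar>l\<bar> * 4 ^ L)\<^sup>2"
    proof -
      have "real y2 \<le> real q ^ nat \<bar>l\<bar> * 2 ^ L"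
      proof (cases "l \<ge> 0")
        case True
        then show ?thesis using mult_left_mono[of 1 "2 ^ L" "real q ^ nat l"] by (simp add: y2_def)
      next
        case False
        have "real p ^ nat (- l) \<le> (2 * real q) ^ nat (- l)" using pq by (intro power_mono) auto
        also have "\<dots> = real q ^ nat (- l) * 2 ^ nat (- l)" by (simp add: power_mult_distrib)
        also have "\<dots> \<le> real q ^ nat (- l) * 2 ^ L" using l False by (intro mult_left_mono power_increasing) auto
        finally show ?thesis using False by (simp add: y2_def)
      qed
      then have "(real y2)\<^sup>2 \<le> (real q ^ nat \<bar>l\<bar> * 2 ^ L)\<^sup>2" by (intro power_mono) auto
      moreover have "exp v powi l \<le> (2 ^ L)\<^sup>2"
      proof -
        have "exp v powi l \<le> exp v powi int L" using l v0 by (intro power_int_increasing) auto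
        also have "\<dots> \<le> 2 ^ L" using ev2 by (simp add: power_mono)
        also have "\<dots> \<le> (2 ^ L)\<^sup>2" by (intro self_le_power) auto
        finally show ?thesis .
      qed
      ultimately have "(real y2)\<^sup>2 * exp v powi l \<le> (real q ^ nat \<bar>l\<bar> * 2 ^ L)\<^sup>2 * (2 ^ L)\<^sup>2"
        by (intro mult_mono) auto
      also have "\<dots> = (real q ^ nat \<bar>l\<bar> * 4 ^ L)\<^sup>2"
      proof -
        have "(4::real) ^ L = 2 ^ L * 2 ^ L" by (simp flip: power_mult_distrib)
        then show ?thesis by (simp add: power_mult_distrib)
      qed
      finally show ?thesis .
    qed
    have "(real y * E)\<^sup>2 = ((real y1)\<^sup>2 * z powi k) * ((real y2)\<^sup>2 * exp v powi l)"
      by (simp add: power_mult_distrib E2 y_def)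
    also have "\<dots> \<le> (real a ^ nat \<bar>k\<bar>)\<^sup>2 * (real q ^ nat \<bar>l\<bar> * 4 ^ L)\<^sup>2"
      using k1 l1 z by (intro mult_mono) auto
    also have "\<dots> = (real a ^ nat \<bar>k\<bar> * (real q ^ nat \<bar>l\<bar> * 4 ^ L))\<^sup>2" by (simp add: power_mult_distrib)
    finally have "real y * E \<le> real a ^ nat \<bar>k\<bar> * (real q ^ nat \<bar>l\<bar> * 4 ^ L)"
      by (rule power2_le_imp_le) auto
    also have "\<dots> \<le> (real q ^ nat (int L - \<bar>l\<bar>) * real a ^ S) * (real q ^ nat \<bar>l\<bar> * 4 ^ L)"
      using kq by (intro mult_right_mono) auto
    also have "\<dots> = real q ^ (nat (int L - \<bar>l\<bar>) + nat \<bar>l\<bar>) * real a ^ S * 4 ^ L"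
      by (simp add: power_add)
    also have "nat (int L - \<bar>l\<bar>) + nat \<bar>l\<bar> = L" using l by simp
    finally show ?thesis by (simp add: W_def)
  qed
  have Eh: "exp (- h * v * of_int m) * E ^ (S - 1) = 1"
  proof -
    have "E ^ (S - 1) = exp (real (S - 1) * (v * of_int m / 2))" unfolding E_def by (rule exp_of_nat_mult[symmetric])
    also have "real (S - 1) = 2 * h" using S by (simp add: h_def)
    finally have "E ^ (S - 1) = exp (h * v * of_int m)" by (simp add: mult_ac)
    then show ?thesis by (simp flip: exp_add)
  qed
  define \<rho> where "\<rho> = (w / exp v) powi l"
  have g\<rho>: "g = E\<^sup>2 * \<rho>" by (simp add: g_def E2 \<rho>_def power_int_divide_distrib)
  \<comment> \<open>The first sum is the exponential polynomial at the root itself; the second,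
    which vanishes for \<open>\<rho> = 1\<close>, is the price of working with
    \<open>w\<close>.\<close>
  have eqf: "\<Phi> * exp (- h * v * of_int m) =
      (\<Sum>t<T. \<Sum>s<S. of_int (c t s) * real (C t) * exp ((real s - h) * v * of_int m))
     + (\<Sum>t<T. \<Sum>s<S. of_int (c t s) * real (C t) * exp ((real s - h) * v * of_int m) * (\<rho> ^ s - 1))"
  proof -
    have "g ^ s * exp (- h * v * of_int m) = exp ((real s - h) * v * of_int m) + exp ((real s - h) * v * of_int m) * (\<rho> ^ s - 1)" for s
    proof -
      have "(E\<^sup>2) ^ s = exp (real s * (v * of_int m))"
        unfolding E_def by (simp add: power2_eq_square exp_of_nat_mult flip: exp_add)
      then have "g ^ s * exp (- h * v * of_int m) = \<rho> ^ s * (exp (real s * (v * of_int m)) * exp (- h * v * of_int m))"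
        by (simp add: g\<rho> power_mult_distrib)
      also have "exp (real s * (v * of_int m)) * exp (- h * v * of_int m) = exp ((real s - h) * v * of_int m)"
        by (simp add: algebra_simps flip: exp_add)
      finally show ?thesis by (simp add: algebra_simps)
    qed
    then have "of_int (c t s) * real (C t) * (g ^ s * exp (- h * v * of_int m)) =
       of_int (c t s) * real (C t) * exp ((real s - h) * v * of_int m)
       + of_int (c t s) * real (C t) * exp ((real s - h) * v * of_int m) * (\<rho> ^ s - 1)" for t s
      by (simp add: algebra_simps)
    then show ?thesis unfolding \<Phi>_def by (simp add: sum_distrib_right mult.assoc flip: sum.distrib)
  qed
  have pert: "\<bar>\<Sum>t<T. \<Sum>s<S. of_int (c t s) * real (C t) * exp ((real s - h) * v * of_int m) * (\<rho> ^ s - 1)\<bar> \<le> \<delta>"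
  proof -
    have one: "\<bar>of_int (c t s) * real (C t) * exp ((real s - h) * v * of_int m) * (\<rho> ^ s - 1)\<bar>
        \<le> H * exp (real T / 2) * exp Y * (2 * real (L * S) * \<epsilon>)" if ts: "t < T" "s < S" for t s
    proof -
      have "real (C t) \<le> real (2 * B choose t)"
        using mB unfolding C_def of_nat_le_iff by (intro binomial_right_mono) auto
      also have "\<dots> \<le> exp (real T / 2) * (4 * real B / real T) ^ t"
        by (rule binomial_le_exp) (use T TB in auto)
      finally have C: "real (C t) \<le> exp (real T / 2) * (4 * real B / real T) ^ t" .
      have "\<bar>real_of_int (c t s)\<bar> * real (C t) \<le> (H * (real T / (4 * real B * r)) ^ t) * (exp (real T / 2) * (4 * real B / real T) ^ t)"
        using c(2)[OF ts] C H r by (intro mult_mono) auto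
      also have "\<dots> = H * exp (real T / 2) * (real T / (4 * real B * r) * (4 * real B / real T)) ^ t"
        unfolding power_mult_distrib by (simp add: mult_ac)
      also have "real T / (4 * real B * r) * (4 * real B / real T) = 1 / r" using T TB by simp
      also have "(1 / r) ^ t \<le> 1" using r by (intro power_le_one) auto
      finally have cC: "\<bar>real_of_int (c t s)\<bar> * real (C t) \<le> H * exp (real T / 2)" using H by simp
      have ex: "exp ((real s - h) * v * of_int m) \<le> exp Y"
      proof -
        have "(real s - h) * of_int m \<le> \<bar>real s - h\<bar> * \<bar>of_int m\<bar>"
          by (metis abs_ge_self abs_mult)
        also have "\<dots> \<le> h * real B"
          using ts mB by (intro mult_mono) (auto simp: h_def abs_if field_simps)
        finally have "v * ((real s - h) * of_int m) \<le> v * (h * real B)" using v0 by (intro mult_left_mono) auto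
        then show ?thesis by (simp add: Y h_def mult_ac)
      qed
      have rho: "\<bar>\<rho> ^ s - 1\<bar> \<le> 2 * real (L * S) * \<epsilon>"
      proof -
        have "\<rho> ^ s = (w / exp v) powi (l * int s)" unfolding \<rho>_def by (simp add: power_int_mult power_int_power)
        moreover have "\<bar>l * int s\<bar> \<le> int (L * S)" using l ts by (auto simp: abs_mult intro!: mult_mono)
        ultimately show ?thesis using power_int_near_one[OF \<epsilon>(1) _ \<epsilon>(2)] by simp
      qed
      have "\<bar>of_int (c t s) * real (C t) * exp ((real s - h) * v * of_int m) * (\<rho> ^ s - 1)\<bar> =
         (\<bar>real_of_int (c t s)\<bar> * real (C t)) * exp ((real s - h) * v * of_int m) * \<bar>\<rho> ^ s - 1\<bar>"
        by (simp add: abs_mult)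
      also have "\<dots> \<le> (H * exp (real T / 2)) * exp Y * (2 * real (L * S) * \<epsilon>)"
        by (rule mult_mono[OF mult_mono[OF cC ex] rho]) (use H in auto)
      finally show ?thesis .
    qed
    have "\<bar>\<Sum>t<T. \<Sum>s<S. of_int (c t s) * real (C t) * exp ((real s - h) * v * of_int m) * (\<rho> ^ s - 1)\<bar>
      \<le> (\<Sum>t<T. \<Sum>s<S. H * exp (real T / 2) * exp Y * (2 * real (L * S) * \<epsilon>))"
      by (rule order_trans[OF sum_abs], rule sum_mono, rule order_trans[OF sum_abs], rule sum_mono) (use one in auto)
    also have "\<dots> = real (S * T) * H * exp (real T / 2) * (2 * real (L * S) * \<epsilon> * exp Y)" by simp
    also have "\<dots> \<le> real (S * T) * H * exp (real T / 2) * (exp (r * Y) / r ^ D)"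
      using close H by (intro mult_left_mono) auto
    also have "\<dots> = \<delta>" by (simp add: \<delta>_def exp_add)
    finally show ?thesis .
  qed
  have "\<bar>\<Phi> * exp (- h * v * of_int m)\<bar> \<le> (real D + 2) * \<delta> + \<delta>"
    unfolding eqf using c(3)[OF mB] pert abs_triangle_ineq order_trans unfolding C_def by (smt (verit))
  then have up: "\<bar>\<Phi>\<bar> * exp (- h * v * of_int m) \<le> (real D + 3) * \<delta>"
    by (simp add: abs_mult algebra_simps)
  have "1 \<le> \<bar>\<Phi>\<bar> * real y ^ (S - 1) * (exp (- h * v * of_int m) * E ^ (S - 1))" using lower Eh by simp
  also have "\<dots> = (\<bar>\<Phi>\<bar> * exp (- h * v * of_int m)) * (real y * E) ^ (S - 1)" by (simp add: power_mult_distrib)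
  also have "\<dots> \<le> ((real D + 3) * \<delta>) * W ^ (S - 1)"
    by (rule mult_mono[OF up power_mono[OF yE]]) (use E0 order_trans[OF _ up] in auto)
  also have "\<dots> < 1" using small by (simp add: \<delta>_def W_def)
  finally show False by simp
qed

section \<open>Choice of parameters\<close>

lemma exp_le_power:
  fixes x :: real
  assumes "0 \<le> x" "x \<le> real k" "k > 0" "(1 + x / real k + (x / real k)\<^sup>2) ^ k \<le> c"
  shows "exp x \<le> c"
proof -
  have "exp x = exp (x / real k) ^ k" using assms by (simp flip: exp_of_nat_mult)
  also have "\<dots> \<le> (1 + x / real k + (x / real k)\<^sup>2) ^ k"
    using assms by (intro power_mono exp_bound) (auto simp: field_simps)
  finally show ?thesis using assms by simp
qed

lemma exp_ge_power:
  fixes x :: real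
  assumes "0 \<le> x" "k > 0" "c \<le> (1 + x / real k + (x / real k)\<^sup>2 / 2) ^ k"
  shows "c \<le> exp x"
proof -
  have "(1 + x / real k + (x / real k)\<^sup>2 / 2) ^ k \<le> exp (x / real k) ^ k"
    using assms by (intro power_mono exp_lower_Taylor_quadratic) auto
  also have "\<dots> = exp x" using assms by (simp flip: exp_of_nat_mult)
  finally show ?thesis using assms by simp
qed

lemma exp_109: "exp (109 / 100 :: real) \<le> 3005 / 1000" "29 / 10 \<le> exp (109 / 100 :: real)"
proof -
  show "exp (109 / 100 :: real) \<le> 3005 / 1000"
    by (rule exp_le_power[of _ 64]) (simp_all add: power2_eq_square power_divide)
  show "29 / 10 \<le> exp (109 / 100 :: real)"
    by (rule exp_ge_power[of _ 8]) (simp_all add: power2_eq_square power_divide)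
qed

lemma exp_245: "114 / 10 \<le> exp (245 / 100 :: real)"
  by (rule exp_ge_power[of _ 16]) (simp_all add: power2_eq_square power_divide)

lemma ln_6: "17 / 10 \<le> ln (6 :: real)"
proof -
  have "exp (17 / 10 :: real) \<le> 6"
    by (rule exp_le_power[of _ 16]) (simp_all add: power2_eq_square power_divide)
  then show ?thesis by (subst ln_ge_iff) auto
qed

lemma ln_18: "285 / 100 \<le> ln (18 :: real)"
proof -
  have "exp (285 / 100 :: real) \<le> 18"
    by (rule exp_le_power[of _ 128]) (simp_all add: power2_eq_square power_divide)
  then show ?thesis by (subst ln_ge_iff) auto
qed

lemma ln_5058: "ln (5058 / 10000 :: real) \<le> - 65 / 100"
proof -
  have "(5058 / 10000 :: real) \<le> (1 + - (65 / 800)) ^ 8" by (simp add: power_divide)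
  also have "\<dots> \<le> exp (- (65 / 800)) ^ 8" by (intro power_mono exp_ge_add_one_self) auto
  also have "\<dots> = exp (- 65 / 100)" by (simp flip: exp_of_nat_mult)
  finally have "ln (5058 / 10000 :: real) \<le> ln (exp (- 65 / 100))" by (subst ln_le_cancel_iff) auto
  then show ?thesis by simp
qed

text \<open>Unlike \<open>z - 1\<close>, this bound is exact to second order at 1. For
  \<open>X\<close> near 6 it bounds \<open>\<kappa>\<close> below by about 1.1 instead of
  1.2.\<close>

lemma ln_le_half_diff_inverse:
  fixes z :: real assumes "z \<ge> 1" shows "ln z \<le> (z - 1 / z) / 2"
proof -
  have "(\<lambda>z. (z - 1 / z) / 2 - ln z) 1 \<le> (\<lambda>z. (z - 1 / z) / 2 - ln z) z"
  proof (rule DERIV_nonneg_imp_nondecreasing[OF assms])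
    fix x :: real assume x: "1 \<le> x"
    have "((\<lambda>z. (z - 1 / z) / 2 - ln z) has_real_derivative (1 - 1 / x)\<^sup>2 / 2) (at x)"
      using x by (auto intro!: derivative_eq_intros simp: field_simps power2_eq_square)
    then show "\<exists>y. ((\<lambda>z. (z - 1 / z) / 2 - ln z) has_real_derivative y) (at x) \<and> 0 \<le> y"
      by (intro exI[of _ "(1 - 1 / x)\<^sup>2 / 2"]) auto
  qed
  then show ?thesis by simp
qed

section \<open>The limiting inequality in \<sigma>, \<zeta> and u\<close>

lemma sigma_terms_bound:
  fixes u \<sigma> \<zeta> :: real
  assumes u: "u \<ge> 0" and \<sigma>: "205 / 100 \<le> \<sigma>" "\<sigma> \<le> 215 / 100" and \<zeta>: "0 \<le> \<zeta>" "\<zeta> \<le> 2248 / 10000"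
  shows "(11 * u + 1441 / 1000) / (10 * \<sigma> + 1) + \<sigma> * \<zeta> * u
    \<le> (11 * u + 1441 / 1000) / (215 / 10) + 205 / 100 * \<zeta> * u"
proof -
  \<comment> \<open>The first factor is a line slightly above the chord of the convex function
    \<open>1 / (10 * \<sigma> + 1)\<close>. Since \<open>11 * 0.0206 = 0.2266\<close> exceeds
    \<zeta>, its descent beats the growth of \<open>\<sigma> * \<zeta> * u\<close>, and
    \<open>\<sigma> = 2.05\<close> is the worst case.\<close>
  have "1 \<le> (10 / 215 - 206 / 10000 * (\<sigma> - 205 / 100)) * (10 * \<sigma> + 1)"
  proof -
    have "0 \<le> (\<sigma> - 205 / 100) * (215 / 100 - \<sigma>)" using \<sigma> by simp
    then show ?thesis using \<sigma> unfolding ring_distribs by linarith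
  qed
  then have "1 / (10 * \<sigma> + 1) \<le> 10 / 215 - 206 / 10000 * (\<sigma> - 205 / 100)"
    using \<sigma> by (simp add: divide_simps)
  then have "(11 * u + 1441 / 1000) * (1 / (10 * \<sigma> + 1))
      \<le> (11 * u + 1441 / 1000) * (10 / 215 - 206 / 10000 * (\<sigma> - 205 / 100))"
    using u by (intro mult_left_mono) auto
  moreover have "(\<sigma> - 205 / 100) * (u * (2266 / 10000 - \<zeta>)) \<ge> 0" using u \<sigma> \<zeta> by simp
  then have "(\<sigma> - 205 / 100) * (\<zeta> * u) \<le> (11 * u + 1441 / 1000) * (206 / 10000 * (\<sigma> - 205 / 100))"
    using \<sigma> by (simp add: field_simps)
  ultimately have "(11 * u + 1441 / 1000) * (1 / (10 * \<sigma> + 1)) + \<sigma> * (\<zeta> * u)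
     \<le> (11 * u + 1441 / 1000) * (10 / 215) + 205 / 100 * (\<zeta> * u)"
    unfolding right_diff_distrib left_diff_distrib by linarith
  then show ?thesis by (simp add: mult.assoc)
qed

text \<open>Apart from \<open>y\<close>, the last expression is the coefficient of
  \<open>u\<^sup>2\<close> in the limiting inequality at \<open>\<sigma> = 2.05\<close>; its lower
  bound is the room left by 35.1 = 2 * 17.55. The chord of \<open>\<theta>\<^sup>2\<close> and the
  tangent of \<open>\<zeta>\<^sup>2\<close> at 0.2197 make the estimate linear.\<close>

lemma theta_bound:
  fixes \<zeta> :: real
  defines "\<theta> \<equiv> 1755 / 100 * \<zeta>\<^sup>2"
  assumes "2197 / 10000 \<le> \<zeta>" "\<zeta> \<le> 2248 / 10000"
  shows "8471 / 10000 \<le> \<theta>" "\<theta> \<le> 8870 / 10000"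
    "1458 / 100000 \<le> 2 * \<theta> - \<theta>\<^sup>2 - 11 / (215 / 10) - 205 / 100 * \<zeta>"
proof -
  have "(2197 / 10000)\<^sup>2 \<le> \<zeta>\<^sup>2" "\<zeta>\<^sup>2 \<le> (2248 / 10000)\<^sup>2" using assms by (intro power_mono; simp)+
  then show \<theta>: "8471 / 10000 \<le> \<theta>" "\<theta> \<le> 8870 / 10000" by (simp_all add: \<theta>_def power2_eq_square)
  have "0 \<le> (\<theta> - 8471 / 10000) * (8870 / 10000 - \<theta>)" using \<theta> by simp
  then have "2 * \<theta> - \<theta>\<^sup>2 \<ge> 2659 / 10000 * \<theta> + 75137 / 100000" unfolding power2_eq_square ring_distribs by linarith
  moreover have "2659 / 10000 * \<theta> - 205 / 100 * \<zeta> \<ge> - 22515 / 100000"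
  proof -
    have "0 \<le> (\<zeta> - 2197 / 10000)\<^sup>2" by simp
    then show ?thesis unfolding \<theta>_def using assms by (simp add: power2_eq_square algebra_simps)
  qed
  ultimately show "1458 / 100000 \<le> 2 * \<theta> - \<theta>\<^sup>2 - 11 / (215 / 10) - 205 / 100 * \<zeta>" by simp
qed

text \<open>
  The inequalities below are what remains of the condition \<open>small\<close> of \<open>no_good_approximation\<close> after division by
  \<open>S T\<close> as \<open>q\<close> tends to infinity, with \<open>u = \<eta> ln a\<close>, \<open>\<sigma> = (S - 1) / \<Lambda>\<close>, \<open>\<zeta> = \<Lambda> / (L \<eta>)\<close>,
  \<open>r = exp (u + 1.09)\<close> and \<open>y = r Y / (S T)\<close>; the summand \<open>1 / 1000\<close> absorbs the error terms. The ranges of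
  \<open>\<sigma>\<close> and \<open>\<zeta>\<close> lie around the optimum, where the slack is only about \<open>0.007 u\<close>.
\<close>

lemma main_inequality_reduce:
  fixes u \<sigma> \<zeta> y r :: real
  defines "\<theta> \<equiv> 1755 / 100 * \<zeta>\<^sup>2"
  assumes u: "u \<ge> 1" and \<sigma>: "205 / 100 \<le> \<sigma>" "\<sigma> \<le> 215 / 100" and \<zeta>: "2197 / 10000 \<le> \<zeta>" "\<zeta> \<le> 2248 / 10000"
    and h: "(u + 109 / 100) * (2 / 1000 + (11 * u + 1441 / 1000) / (215 / 10) + 205 / 100 * \<zeta> * u + 2 * (y / r))
       + (\<theta> * u + y)\<^sup>2 < 2 * (\<theta> * u) * (u + 109 / 100)"
  shows "1 / 1000 + (11 * u + 1441 / 1000) / (2 * (10 * \<sigma> + 1)) + (\<theta> * u + y)\<^sup>2 / (2 * (u + 109 / 100))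
     + y / r + \<sigma> * \<zeta> * u / 2 < \<theta> * u"
proof -
  define A where "A = (11 * u + 1441 / 1000) / (10 * \<sigma> + 1) + \<sigma> * \<zeta> * u"
  define A' where "A' = (11 * u + 1441 / 1000) / (215 / 10) + 205 / 100 * \<zeta> * u"
  have A: "A \<le> A'" unfolding A_def A'_def using u \<sigma> \<zeta> by (intro sigma_terms_bound) auto
  have "(\<theta> * u + y)\<^sup>2 < (u + 109 / 100) * (2 * (\<theta> * u) - 2 / 1000 - A' - 2 * (y / r))"
    using h unfolding A'_def by (simp add: algebra_simps)
  then have "(\<theta> * u + y)\<^sup>2 / (u + 109 / 100) < 2 * (\<theta> * u) - 2 / 1000 - A' - 2 * (y / r)"
    using u by (simp add: divide_simps mult.commute)
  moreover have "(11 * u + 1441 / 1000) / (2 * (10 * \<sigma> + 1)) + \<sigma> * \<zeta> * u / 2 = A / 2"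
    using \<sigma> by (simp add: A_def field_simps)
  moreover have "(\<theta> * u + y)\<^sup>2 / (2 * (u + 109 / 100)) = (\<theta> * u + y)\<^sup>2 / (u + 109 / 100) / 2"
    by (simp add: field_simps)
  moreover have "P + R = A / 2 \<Longrightarrow> Z = Q / 2 \<Longrightarrow> Q < 2 * t - 2 / 1000 - A' - 2 * w \<Longrightarrow> 1 / 1000 + P + Z + w + R < t"
    for P Q R Z t w :: real using A by linarith
  ultimately show ?thesis by blast
qed

text \<open>Here \<open>y\<close> is bounded independently of \<open>u\<close>. What remains is a
  quadratic in \<open>u\<close> with positive coefficients of \<open>u\<^sup>2\<close> and
  \<open>u\<close>, so its value at 2.45 decides.\<close>

lemma main_inequality_large:
  fixes u \<sigma> \<zeta> y r :: real
  defines "\<theta> \<equiv> 1755 / 100 * \<zeta>\<^sup>2"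
  assumes u: "u \<ge> 245 / 100" and \<sigma>: "205 / 100 \<le> \<sigma>" "\<sigma> \<le> 215 / 100" and \<zeta>: "2197 / 10000 \<le> \<zeta>" "\<zeta> \<le> 2248 / 10000"
    and y: "0 \<le> y" "y \<le> 79 / 100 * \<sigma> * \<zeta>" and r: "r \<ge> 3306 / 100 * (u - 145 / 100)"
  shows "1 / 1000 + (11 * u + 1441 / 1000) / (2 * (10 * \<sigma> + 1)) + (\<theta> * u + y)\<^sup>2 / (2 * (u + 109 / 100))
     + y / r + \<sigma> * \<zeta> * u / 2 < \<theta> * u"
  unfolding \<theta>_def
proof (rule main_inequality_reduce)
  note th = theta_bound[OF \<zeta>, folded \<theta>_def]
  have "79 / 100 * (\<sigma> * \<zeta>) \<le> 79 / 100 * (215 / 100 * \<zeta>)" using \<sigma> \<zeta> by (intro mult_left_mono mult_right_mono) auto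
  then have yz: "y \<le> 16985 / 10000 * \<zeta>" using y by simp
  then have y': "y \<le> 3819 / 10000" using \<zeta> by simp
  have e: "(u + 109 / 100) * (2 * (y / r)) \<le> 2142 / 10000 * y"
  proof -
    \<comment> \<open>The quotient of \<open>u + 1.09\<close> by \<open>u - 1.45\<close> is largest
      at \<open>u = 2.45\<close>, where it equals 3.54.\<close>
    have "(u + 109 / 100) * 3306 / 100 \<le> 354 / 100 * (3306 / 100 * (u - 145 / 100))" using u by simp
    also have "\<dots> \<le> 354 / 100 * r" using r by simp
    finally have "(u + 109 / 100) * 2 \<le> 2142 / 10000 * r" using r u by simp
    moreover have "r > 0" by (rule less_le_trans[OF _ r]) (use u in simp)
    ultimately have "(u + 109 / 100) * 2 / r \<le> 2142 / 10000" by (simp add: divide_simps)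
    then have "(u + 109 / 100) * 2 / r * y \<le> 2142 / 10000 * y" using y by (intro mult_right_mono)
    then show ?thesis by (simp only: mult_ac times_divide_eq_right times_divide_eq_left)
  qed
  define A1 where "A1 = 218 / 100 * \<theta> - 2 * (\<theta> * y) - (13431 / 1000) / (215 / 10) - 22345 / 10000 * \<zeta>"
  have A1: "A1 \<ge> 985 / 10000"
  proof -
    \<comment> \<open>With \<theta> inserted the bound becomes a cubic in \<zeta>, which is expanded
      at the left end of the range.\<close>
    define d where "d = \<zeta> - 2197 / 10000"
    have d: "0 \<le> d" "d \<le> 51 / 10000" using \<zeta> by (auto simp: d_def)
    have "\<theta> * y \<le> \<theta> * (16985 / 10000 * \<zeta>)" using yz th by (intro mult_left_mono) auto
    then have a: "A1 \<ge> 218 / 100 * \<theta> - 2 * (\<theta> * (16985 / 10000 * \<zeta>)) - (13431 / 1000) / (215 / 10) - 22345 / 10000 * \<zeta>"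
      unfolding A1_def by linarith
    have b: "218 / 100 * \<theta> - 2 * (\<theta> * (16985 / 10000 * \<zeta>)) - (13431 / 1000) / (215 / 10) - 22345 / 10000 * \<zeta>
       \<ge> 985 / 10000 + d * (5 - 3 * d - 60 * d * d)"
    proof -
      have z: "\<zeta> = 2197 / 10000 + d" by (simp add: d_def)
      have n: "0 \<le> d * (d * (d * 7653))" "0 \<le> d * (d * 393040923)" using d by simp_all
      show ?thesis unfolding \<theta>_def z
        by ((simp add: power2_eq_square algebra_simps), insert n d, linarith)
    qed
    have "d * (5 - 3 * d - 60 * d * d) \<ge> 0"
    proof (rule mult_nonneg_nonneg)
      have "d * d \<le> 51 / 10000 * (51 / 10000)" using d by (intro mult_mono) auto
      then show "0 \<le> 5 - 3 * d - 60 * d * d" using d by simp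
    qed (rule d)
    then show ?thesis using a b by linarith
  qed
  have y2: "y\<^sup>2 \<le> (3819 / 10000)\<^sup>2" using y y' by (intro power_mono) auto
  have q: "(1458 / 100000) * u\<^sup>2 + 985 / 10000 * u - 3009 / 10000 - 2 / 1000 * (u + 109 / 100) > 0"
  proof -
    have "(245 / 100)\<^sup>2 \<le> u\<^sup>2" using u by (intro power_mono) auto
    then show ?thesis using u by (simp add: power2_eq_square)
  qed
  have "(1458 / 100000) * u\<^sup>2 \<le> (2 * \<theta> - \<theta>\<^sup>2 - 11 / (215 / 10) - 205 / 100 * \<zeta>) * u\<^sup>2"
    using th(3) by (intro mult_right_mono) auto
  moreover have "985 / 10000 * u \<le> A1 * u" using A1 u by (intro mult_right_mono) auto
  moreover have "y\<^sup>2 + 2142 / 10000 * y + 1441 / 1000 * (109 / 100) / (215 / 10) \<le> 3009 / 10000"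
    using y2 y' by (simp add: power2_eq_square)
  ultimately have "2 / 1000 * (u + 109 / 100) < (2 * \<theta> - \<theta>\<^sup>2 - 11 / (215 / 10) - 205 / 100 * \<zeta>) * u\<^sup>2 + A1 * u
     - (y\<^sup>2 + 2142 / 10000 * y + 1441 / 1000 * (109 / 100) / (215 / 10))" using q by linarith
  then have pos: "0 < (2 * \<theta> - \<theta>\<^sup>2 - 11 / (215 / 10) - 205 / 100 * \<zeta>) * u\<^sup>2 + A1 * u
     - (y\<^sup>2 + 2142 / 10000 * y + 1441 / 1000 * (109 / 100) / (215 / 10)) - 2 / 1000 * (u + 109 / 100)" by simp
  define K where "K = 2 / 1000 + (11 * u + 1441 / 1000) / (215 / 10) + 205 / 100 * \<zeta> * u"
  have "(2 * \<theta> - \<theta>\<^sup>2 - 11 / (215 / 10) - 205 / 100 * \<zeta>) * u\<^sup>2 + A1 * u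
     - (y\<^sup>2 + 2142 / 10000 * y + 1441 / 1000 * (109 / 100) / (215 / 10)) - 2 / 1000 * (u + 109 / 100)
     = 2 * (\<theta> * u) * (u + 109 / 100) - (u + 109 / 100) * K - (\<theta> * u + y)\<^sup>2 - 2142 / 10000 * y"
    unfolding A1_def K_def by (simp add: power2_eq_square field_simps)
  then have "(u + 109 / 100) * K + (\<theta> * u + y)\<^sup>2 + 2142 / 10000 * y < 2 * (\<theta> * u) * (u + 109 / 100)"
    using pos by linarith
  then have "(u + 109 / 100) * (K + 2 * (y / r)) + (\<theta> * u + y)\<^sup>2 < 2 * (\<theta> * u) * (u + 109 / 100)"
    using e unfolding distrib_left[of _ K] by linarith
  then show "(u + 109 / 100) * (2 / 1000 + (11 * u + 1441 / 1000) / (215 / 10) + 205 / 100 * \<zeta> * u + 2 * (y / r))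
       + (1755 / 100 * \<zeta>\<^sup>2 * u + y)\<^sup>2 < 2 * (1755 / 100 * \<zeta>\<^sup>2 * u) * (u + 109 / 100)"
    unfolding \<theta>_def K_def .
qed (use u \<sigma> \<zeta> in auto)

text \<open>For small \<open>u\<close> the bound on \<open>y\<close> is proportional to
  \<open>u\<close>: in the application \<open>ln a \<ge> 2.85\<close> gives
  \<open>\<eta> \<le> u / 2.85\<close>. The resulting quadratic in \<open>u\<close> is concave, so
  only the ends 1.7 and 2.45 matter.\<close>

lemma main_inequality_small:
  fixes u \<sigma> \<zeta> y r :: real
  defines "\<theta> \<equiv> 1755 / 100 * \<zeta>\<^sup>2"
  assumes u: "17 / 10 \<le> u" "u \<le> 245 / 100" and \<sigma>: "205 / 100 \<le> \<sigma>" "\<sigma> \<le> 215 / 100"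
    and \<zeta>: "2197 / 10000 \<le> \<zeta>" "\<zeta> \<le> 2248 / 10000"
    and y: "0 \<le> y" "y \<le> 2903 / 10000 * u * \<sigma> * \<zeta>" and r: "r \<ge> 174 / 10"
  shows "1 / 1000 + (11 * u + 1441 / 1000) / (2 * (10 * \<sigma> + 1)) + (\<theta> * u + y)\<^sup>2 / (2 * (u + 109 / 100))
     + y / r + \<sigma> * \<zeta> * u / 2 < \<theta> * u"
  unfolding \<theta>_def
proof (rule main_inequality_reduce)
  note th = theta_bound[OF \<zeta>, folded \<theta>_def]
  define y1 where "y1 = y / u"
  have yu: "y = y1 * u" using u by (simp add: y1_def)
  have "\<sigma> * \<zeta> \<le> 215 / 100 * (2248 / 10000)" using \<sigma> \<zeta> by (intro mult_mono) auto
  moreover have "y1 \<le> 2903 / 10000 * (\<sigma> * \<zeta>)" using y u by (simp add: y1_def divide_simps mult_ac)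
  ultimately have y1: "0 \<le> y1" "y1 \<le> 1404 / 10000" using y u by (auto simp: y1_def)
  have e: "(u + 109 / 100) * (2 * (y / r)) \<le> 4069 / 10000 * y"
  proof -
    have "(u + 109 / 100) * 2 \<le> 708 / 100" using u by simp
    also have "\<dots> \<le> 4069 / 10000 * r" using r by simp
    finally have "(u + 109 / 100) * 2 / r \<le> 4069 / 10000" using r by (simp add: divide_simps)
    then have "(u + 109 / 100) * 2 / r * y \<le> 4069 / 10000 * y" using y by (intro mult_right_mono)
    then show ?thesis by (simp only: mult_ac times_divide_eq_right times_divide_eq_left)
  qed
  define A1 where "A1 = 218 / 100 * \<theta> - (13431 / 1000) / (215 / 10) - 22345 / 10000 * \<zeta> - 4069 / 10000 * y1"
  have A1: "A1 \<ge> 670 / 1000"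
  proof -
    have "(\<zeta> - 2197 / 10000)\<^sup>2 \<ge> 0" by simp
    then have "\<zeta>\<^sup>2 \<ge> 4394 / 10000 * \<zeta> - 2197 / 10000 * (2197 / 10000)"
      unfolding power2_eq_square left_diff_distrib right_diff_distrib by linarith
    then show ?thesis unfolding A1_def \<theta>_def using y1 \<zeta> by simp
  qed
  define A2 where "A2 = 2 * \<theta> - \<theta>\<^sup>2 - 11 / (215 / 10) - 205 / 100 * \<zeta> - 2 * (\<theta> * y1) - y1\<^sup>2"
  have A2: "A2 \<ge> - 2546 / 10000"
  proof -
    have "\<theta> * y1 \<le> 8870 / 10000 * (1404 / 10000)" using th y1 by (intro mult_mono) auto
    moreover have "y1\<^sup>2 \<le> (1404 / 10000)\<^sup>2" using y1 by (intro power_mono) auto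
    ultimately show ?thesis unfolding A2_def using th(3) by (simp add: power2_eq_square)
  qed
  \<comment> \<open>Replacing \<open>u\<^sup>2\<close> by its chord over the interval leaves a
    linear inequality.\<close>
  have q: "(- 2546 / 10000) * u\<^sup>2 + 670 / 1000 * u - 731 / 10000 - 2 / 1000 * (u + 109 / 100) > 0"
  proof -
    have "(u - 17 / 10) * (245 / 100 - u) \<ge> 0" using u by simp
    then have "u\<^sup>2 \<le> 415 / 100 * u - 17 / 10 * (245 / 100)"
      unfolding power2_eq_square left_diff_distrib right_diff_distrib by linarith
    then show ?thesis using u by simp
  qed
  have "(- 2546 / 10000) * u\<^sup>2 \<le> A2 * u\<^sup>2" using A2 by (intro mult_right_mono) auto
  moreover have "670 / 1000 * u \<le> A1 * u" using A1 u by (intro mult_right_mono) auto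
  ultimately have pos: "0 < A2 * u\<^sup>2 + A1 * u - 1441 / 1000 * (109 / 100) / (215 / 10) - 2 / 1000 * (u + 109 / 100)"
    using q by simp
  define K where "K = 2 / 1000 + (11 * u + 1441 / 1000) / (215 / 10) + 205 / 100 * \<zeta> * u"
  have "A2 * u\<^sup>2 + A1 * u - 1441 / 1000 * (109 / 100) / (215 / 10) - 2 / 1000 * (u + 109 / 100)
     = 2 * (\<theta> * u) * (u + 109 / 100) - (u + 109 / 100) * K - (\<theta> * u + y)\<^sup>2 - 4069 / 10000 * y"
    unfolding A1_def A2_def K_def yu by (simp add: power2_eq_square field_simps)
  then have "(u + 109 / 100) * K + (\<theta> * u + y)\<^sup>2 + 4069 / 10000 * y < 2 * (\<theta> * u) * (u + 109 / 100)"
    using pos by linarith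
  then have "(u + 109 / 100) * (K + 2 * (y / r)) + (\<theta> * u + y)\<^sup>2 < 2 * (\<theta> * u) * (u + 109 / 100)"
    using e unfolding distrib_left[of _ K] by linarith
  then show "(u + 109 / 100) * (2 / 1000 + (11 * u + 1441 / 1000) / (215 / 10) + 205 / 100 * \<zeta> * u + 2 * (y / r))
       + (1755 / 100 * \<zeta>\<^sup>2 * u + y)\<^sup>2 < 2 * (1755 / 100 * \<zeta>\<^sup>2 * u) * (u + 109 / 100)"
    unfolding \<theta>_def K_def .
qed (use u \<sigma> \<zeta> in auto)

text \<open>All exponents are compared in units of \<open>N = S * T\<close>. The threshold on
  \<open>q\<close> forces \<open>M \<ge> 19000 * L * a\<close>, so that the error terms
  \<open>t1\<close> and \<open>t6\<close> take at most \<open>5 / 10000 * N\<close> each, together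
  the \<open>1 / 1000\<close> of the limiting inequality.\<close>

lemma large_denominator:
  fixes a b n q :: nat and p :: int and \<eta> \<Lambda> \<mu> :: real
  assumes \<mu>: "\<mu> = 35.1 / \<eta> * \<Lambda>\<^sup>2"
    and b: "16 < b" and ab: "b < a" and a65: "real a < 6 * real b / 5"
    and \<eta>: "0 < \<eta>" "\<eta> \<le> 1" and eq: "real a - real b = real a powr (1 - \<eta>)"
    and \<Lambda>: "\<Lambda> = max (ln (2 * real n) / (\<eta> * ln (real a))) 10"
    and n: "\<mu> < real n" and q: "a ^ (2000000 * n * a\<^sup>2) \<le> q"
  shows "real q powr (- \<mu>) \<le> \<bar>root n (real a / real b) - of_int p / real q\<bar>"
proof (rule ccontr)
  assume "\<not> ?thesis"
  then have near: "\<bar>root n (real a / real b) - of_int p / real q\<bar> < real q powr (- \<mu>)" by simp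

  define u where "u = \<eta> * ln (real a)"
  \<comment> \<open>With \<open>X = a powr \<eta>\<close> the hypothesis reads
    \<open>a - b = a / X\<close>, so \<open>z = X / (X - 1)\<close> and \<open>ln z\<close> is about
    \<open>1 / X\<close>; the condition \<open>a < 6 * b / 5\<close> becomes
    \<open>X > 6\<close>.\<close>
  define X where "X = exp u"
  define z where "z = real a / real b"
  have a18: "real a \<ge> 18" using b ab by simp
  have a0: "real a > 0" using a18 by simp
  have X: "real a powr (1 - \<eta>) = real a / X"
    using a0 by (simp add: powr_diff X_def u_def powr_def[of _ \<eta>])
  have X0: "X > 0" by (simp add: X_def)
  have "real a / X < real a / 6" using eq X a65 by linarith
  then have X6: "X > 6" using a0 X0 by (simp add: divide_simps)
  have u17: "17 / 10 \<le> u"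
  proof -
    have "ln 6 \<le> ln X" using X6 by (subst ln_le_cancel_iff) auto
    then show ?thesis using ln_6 by (simp add: X_def)
  qed
  have lna: "285 / 100 \<le> ln (real a)"
  proof -
    have "ln 18 \<le> ln (real a)" using a18 by (subst ln_le_cancel_iff) auto
    then show ?thesis using ln_18 by linarith
  qed
  have lna': "ln (real a) \<le> real a" using ln_le_minus_one[OF a0] by linarith
  have \<eta>u: "\<eta> \<le> u / (285 / 100)"
  proof -
    have "\<eta> * (285 / 100) \<le> u" unfolding u_def using lna \<eta> by (intro mult_left_mono) auto
    then show ?thesis by (simp add: divide_simps)
  qed
  have \<Lambda>10: "\<Lambda> \<ge> 10" using \<Lambda> by simp
  have \<Lambda>u: "ln (2 * real n) \<le> \<Lambda> * u"
  proof -
    have "ln (2 * real n) / u \<le> \<Lambda>" using \<Lambda> by (simp add: u_def)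
    then show ?thesis using u17 by (simp add: divide_simps split: if_splits)
  qed
  have zX: "z = X / (X - 1)"
    using eq X b X6 by (simp add: z_def field_simps)
  have z1: "z > 1" using b ab by (simp add: z_def)
  define \<kappa> where "\<kappa> = X * ln z"
  have \<kappa>: "\<kappa> \<le> (2 * X - 1) / (2 * (X - 1))"
  proof -
    have "\<kappa> \<le> X * ((z - 1 / z) / 2)" unfolding \<kappa>_def
      using z1 X0 by (intro mult_left_mono ln_le_half_diff_inverse) auto
    also have "\<dots> = (2 * X - 1) / (2 * (X - 1))" using X6 unfolding zX
      by (simp add: field_simps)
    finally show ?thesis .
  qed
  have \<kappa>0: "\<kappa> \<ge> 0" using X0 z1 by (simp add: \<kappa>_def)
  have \<kappa>11: "\<kappa> \<le> 11 / 10"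
    by (rule order_trans[OF \<kappa>]) (use X6 in \<open>simp add: divide_simps\<close>)

  \<comment> \<open>Rounding loses at most 1, hence at most \<open>\<Lambda> / 10\<close>: so
    \<open>S - 1\<close> stays between 2.05 and 2.15 times \<Lambda>, and \<open>L\<close> between
    4.45 and 4.55 times \<open>\<Lambda> / \<eta>\<close>. The reciprocals of 4.55 and 4.45 give the
    range of \<zeta>.\<close>
  define S where "S = nat \<lfloor>215 / 100 * \<Lambda>\<rfloor> + 1"
  define L where "L = nat \<lfloor>455 / 100 * (\<Lambda> / \<eta>)\<rfloor>"
  have \<Lambda>\<eta>: "\<Lambda> \<le> \<Lambda> / \<eta>" using \<eta> \<Lambda>10 by (simp add: divide_simps mult_left_le)
  have S1: "real S - 1 \<le> 215 / 100 * \<Lambda>" "205 / 100 * \<Lambda> \<le> real S - 1"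
  proof -
    have "real S - 1 = of_int \<lfloor>215 / 100 * \<Lambda>\<rfloor>" using \<Lambda>10 by (simp add: S_def)
    then show "real S - 1 \<le> 215 / 100 * \<Lambda>" "205 / 100 * \<Lambda> \<le> real S - 1" using \<Lambda>10 by linarith+
  qed
  have L1: "real L \<le> 455 / 100 * (\<Lambda> / \<eta>)" "445 / 100 * (\<Lambda> / \<eta>) \<le> real L"
  proof -
    have "real L = of_int \<lfloor>455 / 100 * (\<Lambda> / \<eta>)\<rfloor>" using \<Lambda>10 \<eta> by (simp add: L_def)
    then show "real L \<le> 455 / 100 * (\<Lambda> / \<eta>)" "445 / 100 * (\<Lambda> / \<eta>) \<le> real L"
      using \<Lambda>10 \<Lambda>\<eta> by linarith+
  qed
  have S0: "S > 0" by (simp add: S_def)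
  have L44: "real L \<ge> 44" using L1 \<Lambda>\<eta> \<Lambda>10 by linarith
  have L0: "L > 0" using L44 by (cases L) auto
  have SL: "real S \<le> real L" using S1 L1 \<Lambda>\<eta> \<Lambda>10 by linarith
  define \<sigma> where "\<sigma> = (real S - 1) / \<Lambda>"
  define \<zeta> where "\<zeta> = \<Lambda> / (real L * \<eta>)"
  have \<sigma>: "205 / 100 \<le> \<sigma>" "\<sigma> \<le> 215 / 100" using S1 \<Lambda>10 by (auto simp: \<sigma>_def divide_simps)
  have \<zeta>: "2197 / 10000 \<le> \<zeta>" "\<zeta> \<le> 2248 / 10000"
    using L1 \<Lambda>10 \<eta> L44 by (auto simp: \<zeta>_def field_simps)
  have S\<sigma>: "real S - 1 = \<sigma> * \<Lambda>" using \<Lambda>10 by (simp add: \<sigma>_def)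
  have \<Lambda>L: "\<Lambda> / real L = \<zeta> * \<eta>" using \<eta> by (simp add: \<zeta>_def)
  have nL: "2 * L \<le> n"
  proof -
    have "2 * real L \<le> 35.1 * (\<Lambda> / \<eta>)" using L1 \<Lambda>\<eta> \<Lambda>10 by linarith
    also have "\<dots> = 35.1 * (\<Lambda> / \<eta>) * 1" by simp
    also have "\<dots> \<le> 35.1 * (\<Lambda> / \<eta>) * \<Lambda>" using \<Lambda>10 \<eta> by (intro mult_left_mono) auto
    also have "\<dots> = \<mu>" by (simp add: \<mu> power2_eq_square)
    finally show ?thesis using n by linarith
  qed
  have n0: "n > 0" using nL L0 by simp
  have \<mu>1: "\<mu> \<ge> 1"
  proof -
    have "1 \<le> \<Lambda> / \<eta> * \<Lambda>" using \<Lambda>\<eta> \<Lambda>10 mult_mono[of 1 "\<Lambda> / \<eta>" 1 \<Lambda>] by linarith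
    then show ?thesis unfolding \<mu> by (simp add: power2_eq_square)
  qed
  have L100: "real L \<le> 100 * real n * real a"
  proof -
    have "ln (2 * real n) / u \<le> 2 * real n / 1"
    proof (rule frac_le)
      show "ln (2 * real n) \<le> 2 * real n" using ln_le_minus_one[of "2 * real n"] n0 by simp
    qed (use u17 n0 in auto)
    then have \<Lambda>n: "\<Lambda> \<le> 10 * real n" using \<Lambda> n0 by (auto simp: u_def max_def)
    have "1 / \<eta> = ln (real a) / u" using \<eta> lna by (simp add: u_def)
    also have "\<dots> \<le> real a / 1" using u17 lna' lna by (intro frac_le) auto
    finally have "\<Lambda> * (1 / \<eta>) \<le> 10 * real n * real a" using \<Lambda>n \<Lambda>10 \<eta> by (intro mult_mono) auto
    then have "\<Lambda> / \<eta> \<le> 10 * (real n * real a)" by (simp add: mult.assoc)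
    moreover have "0 \<le> real n * real a" by simp
    ultimately have "real L \<le> 100 * (real n * real a)" using L1 by linarith
    then show ?thesis by (simp add: mult.assoc)
  qed

  have q1: "q \<ge> 1" using q ab by (metis One_nat_def Suc_leI gr0I le_zero_eq not_less_zero power_not_zero)
  have "2 \<le> a ^ S"
  proof -
    have "2 \<le> a" using b ab by simp
    also have "a \<le> a ^ S" using S0 by (intro self_le_power) (use b ab in auto)
    finally show ?thesis .
  qed
  \<comment> \<open>Powers of \<open>a ^ S\<close> instead of \<open>a\<close> make \<open>M\<close>
    a multiple of \<open>S\<close>, so that \<open>S * T = 2 * M * L\<^sup>2\<close> holds
    exactly.\<close>
  from ex_power_ivl1[OF this q1] obtain j where j: "(a ^ S) ^ j \<le> q" "q < (a ^ S) ^ (j + 1)" by auto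
  define M where "M = S * j"
  define T where "T = 2 * j * L\<^sup>2"
  define B where "B = n * (M * L + S) + L"
  have aM: "a ^ M \<le> q" using j(1) by (simp add: M_def power_mult)
  have aMS: "q < a ^ (M + S)" using j(2) by (simp add: M_def power_mult power_add mult.commute)
  have M: "real M \<ge> 19000 * real L * real a"
  proof -
    have "a ^ (2000000 * n * a\<^sup>2) < a ^ (M + S)" using q aMS by simp
    then have "2000000 * n * a\<^sup>2 < M + S" using b ab by (subst (asm) power_strict_increasing_iff) auto
    then have "real (2000000 * n * a\<^sup>2) < real (M + S)" by (simp only: of_nat_less_iff)
    then have 1: "2000000 * (real n * (real a * real a)) < real M + real S" by (simp add: power2_eq_square)
    have 2: "real L * real a \<le> 100 * (real n * (real a * real a))"
      using mult_right_mono[OF L100, of "real a"] by (simp add: mult_ac)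
    have 3: "real S \<le> real L * real a" using SL mult_left_mono[of 1 "real a" "real L"] a18 by simp
    show ?thesis using 1 2 3 by linarith
  qed
  have LLa: "real L \<le> real L * real a" "44 * 18 \<le> real L * real a"
    using mult_left_mono[of 1 "real a" "real L"] mult_mono[of 44 "real L" 18 "real a"] a18 L44 by simp_all
  have M0: "real M > 0" and M2: "real M \<ge> 2000" using M LLa by linarith+
  have j0: "j > 0" using M0 by (cases j) (auto simp: M_def)
  have T0: "T > 0" using j0 L0 by (simp add: T_def)
  define N where "N = real (S * T)"
  have N: "N = 2 * real M * (real L)\<^sup>2" by (simp add: N_def T_def M_def)
  have N0: "N > 0" using M0 L0 by (simp add: N)
  have TN: "real T = N / real S" using S0 by (simp add: N_def)
  have B1: "real B \<le> 1001 / 1000 * (real n * real M * real L)"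
  proof -
    have "real n * real S + real L \<le> real n * real L + real n * real L"
      using SL n0 mult_right_mono[of 1 "real n" "real L"] by (intro add_mono mult_left_mono) auto
    also have "\<dots> = real n * real L * 2" by simp
    also have "\<dots> \<le> real n * real L * (1 / 1000 * real M)" using M2 by (intro mult_left_mono) auto
    finally show ?thesis by (simp add: B_def algebra_simps)
  qed
  have BT: "T \<le> B"
  proof -
    have "j * 1 * (2 * L * L) \<le> j * S * (n * L)" using nL S0 by (intro mult_mono) auto
    then have "T \<le> n * (M * L)" by (simp add: T_def M_def power2_eq_square mult_ac)
    then show ?thesis by (simp add: B_def algebra_simps)
  qed
  have B0: "B > 0" using T0 BT by simp

  define v where "v = ln (real a / real b) / real n"
  have v0: "v > 0" using z1 n0 by (simp add: v_def z_def[symmetric])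
  define Y where "Y = (real S - 1) / 2 * v * real B"
  have Y0: "Y \<ge> 0" using S0 v0 by (simp add: Y_def)
  \<comment> \<open>\<open>Y\<close> is proportional to \<open>ln z\<close>, about
    \<open>1 / X\<close>, so a radius proportional to \<open>X\<close> keeps
    \<open>r * Y / N\<close> bounded. The factor \<open>exp 1.09\<close>, about 3, is fixed
    numerically.\<close>
  define r where "r = exp (u + 109 / 100)"
  have lnr: "ln r = u + 109 / 100" by (simp add: r_def)
  have rX: "r = exp (109 / 100) * X" by (simp add: r_def X_def exp_add)
  have r174: "r \<ge> 174 / 10"
    unfolding rX using mult_mono[of "29 / 10" "exp (109 / 100)" 6 X] exp_109 X6 by simp
  have r2: "r \<ge> 2" using r174 by simp
  have lnr0: "ln r > 0" using u17 lnr by simp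
  define y where "y = r * Y / N"
  have y0: "y \<ge> 0" using r2 Y0 N0 by (simp add: y_def)
  have rY: "r * Y = N * y" using N0 by (simp add: y_def)
  \<comment> \<open>Since \<open>v = ln z / n\<close> and \<open>B\<close> is about
    \<open>n * M * L\<close>, the degree \<open>n\<close> cancels; 0.7521 bounds
    \<open>1.001 * exp 1.09 / 4\<close>.\<close>
  have y1: "y \<le> 7521 / 10000 * (\<kappa> * \<eta>) * \<sigma> * \<zeta>"
  proof -
    have "Y \<le> (real S - 1) / 2 * v * (1001 / 1000 * (real n * real M * real L))"
      unfolding Y_def using B1 S0 v0 by (intro mult_left_mono) auto
    also have "\<dots> = 1001 / 2000 * (real S - 1) * ln z * (real M * real L)"
      using n0 by (simp add: v_def z_def)
    finally have "r * Y \<le> r * (1001 / 2000 * (real S - 1) * ln z * (real M * real L))"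
      using r2 by (intro mult_left_mono) auto
    then have "y \<le> r * (1001 / 2000 * (real S - 1) * ln z * (real M * real L)) / N"
      unfolding y_def using N0 by (intro divide_right_mono) auto
    also have "\<dots> = 1001 / 4000 * exp (109 / 100) * (\<kappa> * ((real S - 1) / real L))"
      unfolding N rX \<kappa>_def using M0 L0 by (simp add: field_simps power2_eq_square)
    also have "(real S - 1) / real L = \<sigma> * (\<zeta> * \<eta>)" unfolding S\<sigma> using \<Lambda>L by (simp add: mult.assoc flip: times_divide_eq_right)
    also have "1001 / 4000 * exp (109 / 100) * (\<kappa> * (\<sigma> * (\<zeta> * \<eta>))) \<le> 7521 / 10000 * (\<kappa> * (\<sigma> * (\<zeta> * \<eta>)))"
      using exp_109 \<kappa>0 \<sigma> \<zeta> \<eta> by (intro mult_right_mono) auto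
    finally show ?thesis by (simp add: mult_ac)
  qed
  define \<theta> where "\<theta> = 1755 / 100 * \<zeta>\<^sup>2"
  have MI: "1 / 1000 + (11 * u + 1441 / 1000) / (2 * (10 * \<sigma> + 1)) + (\<theta> * u + y)\<^sup>2 / (2 * (u + 109 / 100))
     + y / r + \<sigma> * \<zeta> * u / 2 < \<theta> * u"
  proof (cases "u \<ge> 245 / 100")
    case True
    have e: "exp u \<ge> 114 / 10 * (u - 145 / 100)"
    proof -
      have "exp u = exp (245 / 100) * exp (u - 245 / 100)" by (simp flip: exp_add)
      also have "\<dots> \<ge> 114 / 10 * (1 + (u - 245 / 100))"
        using exp_245 True exp_ge_add_one_self[of "u - 245 / 100"] by (intro mult_mono) auto
      finally show ?thesis by simp
    qed
    have "X \<ge> 11" using e True by (simp add: X_def)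
    then have "\<kappa> \<le> 105 / 100" by (intro order_trans[OF \<kappa>]) (simp add: divide_simps)
    then have "\<kappa> * \<eta> \<le> 105 / 100 * 1" using \<eta> \<kappa>0 by (intro mult_mono) auto
    then have "7521 / 10000 * (\<kappa> * \<eta>) \<le> 79 / 100" by linarith
    then have "7521 / 10000 * (\<kappa> * \<eta>) * \<sigma> * \<zeta> \<le> 79 / 100 * \<sigma> * \<zeta>" using \<sigma> \<zeta> by (intro mult_right_mono) auto
    then have yy: "y \<le> 79 / 100 * \<sigma> * \<zeta>" using y1 by linarith
    have "3306 / 100 * (u - 145 / 100) = 29 / 10 * (114 / 10 * (u - 145 / 100))" by simp
    also have "\<dots> \<le> exp (109 / 100) * exp u" using exp_109 e True by (intro mult_mono) auto
    finally have "r \<ge> 3306 / 100 * (u - 145 / 100)" by (simp add: rX X_def)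
    then show ?thesis unfolding \<theta>_def by (intro main_inequality_large True \<sigma> \<zeta> y0 yy)
  next
    case False
    have "\<kappa> * \<eta> \<le> 11 / 10 * (u / (285 / 100))" using \<eta> \<eta>u \<kappa>11 \<kappa>0 by (intro mult_mono) auto
    also have "11 / 10 * (u / (285 / 100)) = 22 / 57 * u" by simp
    finally have "7521 / 10000 * (\<kappa> * \<eta>) \<le> 2903 / 10000 * u" using u17 by linarith
    then have "7521 / 10000 * (\<kappa> * \<eta>) * \<sigma> * \<zeta> \<le> 2903 / 10000 * u * \<sigma> * \<zeta>"
      using \<sigma> \<zeta> by (intro mult_right_mono) auto
    then have yy: "y \<le> 2903 / 10000 * u * \<sigma> * \<zeta>" using y1 by linarith
    show ?thesis unfolding \<theta>_def using False by (intro main_inequality_small u17 \<sigma> \<zeta> y0 yy r174) auto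
  qed
  have \<theta>b: "\<theta> \<le> 8870 / 10000" unfolding \<theta>_def by (rule theta_bound[OF \<zeta>])
  have \<theta>0: "\<theta> \<ge> 0" by (simp add: \<theta>_def)
  have y04: "y \<le> 4 / 10"
  proof -
    have "\<kappa> * \<eta> \<le> 11 / 10 * 1" using \<eta> \<kappa>11 \<kappa>0 by (intro mult_mono) auto
    then have "7521 / 10000 * (\<kappa> * \<eta>) * \<sigma> * \<zeta> \<le> 7521 / 10000 * (11 / 10) * (215 / 100) * (2248 / 10000)"
      using \<sigma> \<zeta> \<kappa>0 \<eta> by (intro mult_mono) auto
    also have "\<dots> \<le> 4 / 10" by simp
    finally show ?thesis using y1 by (rule order_trans[rotated])
  qed
  have M\<mu>: "real M * \<mu> * ln (real a) = N * (\<theta> * u)"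
    using L0 \<eta> by (simp add: \<mu> N \<theta>_def \<zeta>_def u_def field_simps power2_eq_square)

  \<comment> \<open>Taking logarithms in \<open>close\<close> gives
    \<open>D * ln r \<le> \<Xi>\<close>; \<open>D\<close> is the largest such integer.\<close>
  define \<Xi> where "\<Xi> = real M * \<mu> * ln (real a) - ln (2 * real (L * S)) + (r - 1) * Y"
  have ln2LS: "0 \<le> ln (2 * real (L * S))" "ln (2 * real (L * S)) \<le> 2 * (real L)\<^sup>2"
  proof -
    have "1 \<le> real (L * S)" using L0 S0 by (metis One_nat_def Suc_leI nat_0_less_mult_iff of_nat_1 of_nat_mono)
    then show "0 \<le> ln (2 * real (L * S))" by simp
    have "ln (2 * real (L * S)) \<le> 2 * real (L * S)"
      using ln_le_minus_one[of "2 * real (L * S)"] L0 S0 by simp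
    also have "\<dots> \<le> 2 * (real L * real L)" using SL by (simp add: mult_left_mono)
    finally show "ln (2 * real (L * S)) \<le> 2 * (real L)\<^sup>2" by (simp add: power2_eq_square)
  qed
  have \<Xi>1: "ln (2 * real (L * S)) \<le> real M * \<mu> * ln (real a)"
  proof -
    have "ln (2 * real (L * S)) = ln 2 + ln (real L) + ln (real S)"
      using L0 S0 by (simp add: ln_mult)
    also have "\<dots> \<le> 1 + real L + real L"
      using ln_le_minus_one[of "real L"] ln_le_minus_one[of "real S"] L0 S0 SL ln_2_less_1 by simp
    also have "\<dots> \<le> real M" using M LLa L44 by linarith
    also have "\<dots> \<le> real M * \<mu>" using \<mu>1 M0 by simp
    also have "\<dots> \<le> real M * \<mu> * ln (real a)" using lna \<mu>1 M0 by simp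
    finally show ?thesis .
  qed
  have \<Xi>0: "\<Xi> \<ge> 0" unfolding \<Xi>_def using \<Xi>1 r2 Y0 by (simp add: add_nonneg_nonneg)
  define D where "D = nat \<lfloor>\<Xi> / ln r\<rfloor>"
  have "real D \<le> \<Xi> / ln r" unfolding D_def using \<Xi>0 lnr0 by simp
  then have D1: "real D * ln r \<le> \<Xi>" using lnr0 by (simp add: field_simps)
  have "\<Xi> / ln r \<le> real D + 1" unfolding D_def using \<Xi>0 lnr0 by linarith
  then have D2: "\<Xi> \<le> real D * ln r + ln r" using lnr0 by (simp add: field_simps)
  have \<Xi>X: "\<Xi> \<le> N * (\<theta> * u + y)"
    unfolding \<Xi>_def M\<mu> using ln2LS Y0 rY by (simp add: algebra_simps)
  have DN: "real D * ln r \<le> N * (\<theta> * u + y)" using D1 \<Xi>X by linarith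
  have DN': "real D \<le> N"
  proof -
    have "\<theta> * u \<le> 8870 / 10000 * u" using \<theta>b u17 by (intro mult_right_mono) auto
    then have "\<theta> * u + y \<le> ln r" unfolding lnr using y04 u17 by linarith
    then have "N * (\<theta> * u + y) \<le> N * ln r" using N0 by (intro mult_left_mono) auto
    then have "real D * ln r \<le> N * ln r" using DN by linarith
    then show ?thesis using lnr0 by simp
  qed

  \<comment> \<open>By \<open>a ^ M \<le> q\<close> this is at least
    \<open>q powr (- \<mu>)\<close>, and its exponent is exactly
    \<open>N * (\<theta> * u)\<close>.\<close>
  define \<epsilon> where "\<epsilon> = exp (- (real M * \<mu> * ln (real a)))"
  have lnq1: "real M * ln (real a) \<le> ln (real q)"
  proof -
    have "ln (real (a ^ M)) \<le> ln (real q)" using aM a0 q1 by (subst ln_le_cancel_iff) (auto simp del: of_nat_power)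
    then show ?thesis using a0 by (simp add: ln_realpow)
  qed
  have lnq2: "ln (real q) \<le> (real M + real S) * ln (real a)"
  proof -
    have "ln (real q) \<le> ln (real (a ^ (M + S)))" using aMS a0 q1 by (subst ln_le_cancel_iff) (auto simp del: of_nat_power)
    then show ?thesis using a0 by (simp add: ln_realpow)
  qed
  have q\<epsilon>: "real q powr (- \<mu>) \<le> \<epsilon>"
  proof -
    have "\<mu> * (real M * ln (real a)) \<le> \<mu> * ln (real q)" using lnq1 \<mu>1 by (intro mult_left_mono) auto
    then show ?thesis using q1 by (simp add: powr_def \<epsilon>_def mult_ac)
  qed
  have \<epsilon>1: "2 * real (L * S) * \<epsilon> = exp (ln (2 * real (L * S)) - real M * \<mu> * ln (real a))"
    using L0 S0 by (simp add: \<epsilon>_def exp_diff exp_minus divide_inverse)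
  have \<epsilon>2: "2 * real (L * S) * \<epsilon> \<le> 1" unfolding \<epsilon>1 using \<Xi>1 by simp
  have \<epsilon>half: "\<epsilon> \<le> 1 / 2"
  proof -
    have "1 \<le> real (L * S)" using L0 S0 by (metis One_nat_def Suc_leI nat_0_less_mult_iff of_nat_1 of_nat_mono)
    then have "2 * 1 * \<epsilon> \<le> 2 * real (L * S) * \<epsilon>" by (intro mult_right_mono mult_left_mono) (auto simp: \<epsilon>_def)
    then show ?thesis using \<epsilon>2 by linarith
  qed
  have root: "root n z = exp v"
  proof -
    have "exp v ^ n = z" using n0 z1 by (simp add: v_def z_def[symmetric] flip: exp_of_nat_mult)
    then show ?thesis using n0 by (metis exp_gt_zero less_imp_le real_root_power_cancel)
  qed
  have near': "\<bar>of_int p / real q - exp v\<bar> < \<epsilon>"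
    using near q\<epsilon> unfolding z_def[symmetric] root by (simp add: abs_minus_commute)
  have ev1: "exp v \<ge> 1" using v0 by simp
  have ev2: "exp v \<le> 12 / 10"
  proof -
    have "v * 1 \<le> v * real n" using n0 v0 by (intro mult_left_mono) auto
    then have "exp v \<le> exp (v * real n)" by simp
    also have "\<dots> = z" using n0 z1 by (simp add: v_def z_def[symmetric])
    also have "z \<le> 12 / 10" using a65 b by (simp add: z_def divide_simps)
    finally show ?thesis .
  qed
  have p0: "p > 0"
  proof (rule ccontr)
    assume "\<not> p > 0"
    then have "of_int p / real q \<le> 0" by (simp add: divide_nonpos_nonneg)
    then show False using near' ev1 \<epsilon>half by linarith
  qed
  define P where "P = nat p"
  have P: "of_int p = real P" "P > 0" using p0 by (auto simp: P_def)
  have Pq: "P \<le> 2 * q"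
  proof -
    have "real P / real q \<le> 2" using near' ev2 \<epsilon>half unfolding P(1) by linarith
    then have "real P \<le> real (2 * q)" using q1 by (simp add: divide_simps split: if_splits)
    then show ?thesis by (simp only: of_nat_le_iff)
  qed
  have rel: "\<bar>real P / real q / exp v - 1\<bar> \<le> \<epsilon>"
  proof -
    have "real P / real q / exp v - 1 = (real P / real q - exp v) / exp v" by (simp add: field_simps)
    also have "\<bar>\<dots>\<bar> = \<bar>real P / real q - exp v\<bar> / exp v" by simp
    also have "\<dots> \<le> \<epsilon> / 1" using near' ev1 P by (intro frac_le) auto
    finally show ?thesis by simp
  qed
  have close: "2 * real (L * S) * \<epsilon> * exp Y \<le> exp (r * Y) / r ^ D"
  proof -
    have "r ^ D = exp (real D * ln r)" using r2 by (simp add: exp_of_nat_mult)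
    then have "exp (r * Y) / r ^ D = exp (r * Y - real D * ln r)" by (simp add: exp_diff)
    moreover have "2 * real (L * S) * \<epsilon> * exp Y = exp (r * Y - \<Xi>)"
      unfolding \<epsilon>1 by (simp add: \<Xi>_def algebra_simps flip: exp_add)
    ultimately show ?thesis using D1 by simp
  qed
  \<comment> \<open>This solves \<open>count\<close> for \<open>ln H\<close>, with
    \<open>T * (T - 1)\<close> raised to \<open>T * T\<close> and \<open>D + 1\<close> to
    \<open>D + 3\<close>; the latter absorbs \<open>D * ln 2\<close> because
    \<open>2 \<le> r\<close>.\<close>
  define lH where "lH = real T / 2 * ln (4 * real B * r / real T) + real D * (real D + 3) / (2 * N) * ln r"
  have arg1: "1 \<le> 4 * real B * r / real T"
  proof -
    have "real T * 1 \<le> (4 * real B) * r" using BT r2 by (intro mult_mono) auto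
    then show ?thesis using T0 by simp
  qed
  have count: "real D * ln 2 + real D * (real D + 1) / 2 * ln r
        + real S * (real T * (real T - 1) / 2) * ln (4 * real B * r / real T) \<le> real (S * T) * ln (exp lH)"
  proof -
    have l2: "ln 2 \<le> ln r" using r2 by simp
    have "real D * ln 2 \<le> real D * ln r" using l2 by (intro mult_left_mono) auto
    then have "real D * ln 2 + real D * (real D + 1) / 2 * ln r \<le> real D * (real D + 3) / 2 * ln r"
      by (simp add: field_simps)
    moreover have "real S * (real T * (real T - 1) / 2) * ln (4 * real B * r / real T)
       \<le> real S * (real T * real T / 2) * ln (4 * real B * r / real T)"
      using arg1 by (intro mult_right_mono mult_left_mono divide_right_mono) auto
    moreover have "real (S * T) * lH = real S * (real T * real T / 2) * ln (4 * real B * r / real T) + real D * (real D + 3) / 2 * ln r"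
    proof -
      have "N * (real D * (real D + 3) / (2 * N) * ln r) = real D * (real D + 3) / 2 * ln r" using N0 by simp
      then have "N * lH = N * (real T / 2 * ln (4 * real B * r / real T)) + real D * (real D + 3) / 2 * ln r"
        unfolding lH_def distrib_left by simp
      then show ?thesis by (simp add: N_def)
    qed
    ultimately show ?thesis by simp
  qed

  have t1: "ln (real D + 3) + ln N \<le> 5 / 10000 * N"
  proof -
    have N6: "N \<ge> 64200000"
    proof -
      have "real M \<ge> 19000 * (44 * 18)" using M LLa by linarith
      moreover have "44 * 44 \<le> (real L)\<^sup>2" unfolding power2_eq_square using L44 by (intro mult_mono) auto
      ultimately have "2 * (19000 * (44 * 18)) * (44 * 44) \<le> N" unfolding N by (intro mult_mono) auto
      then show ?thesis by simp
    qed
    have s: "sqrt (N + 3) > 0" using N0 by simp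
    have "ln (N + 3) = 2 * ln (sqrt (N + 3))" using N0 by (simp add: ln_sqrt)
    also have "\<dots> \<le> 2 * sqrt (N + 3)" using ln_le_minus_one[OF s] by simp
    finally have 1: "ln (N + 3) \<le> 2 * sqrt (N + 3)" .
    have "sqrt (N + 3) \<le> 125 / 1000000 * N"
    proof (rule real_le_lsqrt)
      have "64200000 * N \<le> N * N" using N6 N0 by (intro mult_right_mono) auto
      moreover have "(125 / 1000000 * N)\<^sup>2 = N * N / 64000000" by (simp add: power2_eq_square)
      ultimately show "N + 3 \<le> (125 / 1000000 * N)\<^sup>2" using N6 by linarith
    qed (use N0 in auto)
    moreover have "ln (real D + 3) \<le> ln (N + 3)" "ln N \<le> ln (N + 3)" using DN' N0 by auto
    ultimately show ?thesis using 1 by linarith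
  qed
  \<comment> \<open>Here \<open>4 * B / T\<close> is about \<open>2 * n * S / L\<close>, and
    \<open>S / L \<le> 2.25 * 0.2248 = 0.5058\<close>. The constant is
    \<open>1.441 = 0.001 - 0.65 + 1.09 + 1\<close>, where -0.65 bounds \<open>ln 0.5058\<close>,
    1.09 is from \<open>ln r\<close> and 1 from the factor \<open>exp (T / 2)\<close>.\<close>
  have t2: "real T / 2 * (ln (4 * real B * r / real T) + 1) \<le> N * ((11 * u + 1441 / 1000) / (2 * (10 * \<sigma> + 1)))"
  proof -
    have "4 * real B / real T \<le> 4 * (1001 / 1000 * (real n * real M * real L)) / real T"
      by (intro divide_right_mono mult_left_mono B1) auto
    also have "\<dots> = 1001 / 1000 * (2 * real n) * (real S / real L)"
      using M0 L0 S0 unfolding TN N by (simp add: field_simps power2_eq_square)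
    also have "\<dots> \<le> 1001 / 1000 * (2 * real n) * (5058 / 10000)"
    proof (rule mult_left_mono)
      have "real S \<le> 225 / 100 * \<Lambda>" using S1 \<Lambda>10 by linarith
      then have "real S / real L \<le> 225 / 100 * \<Lambda> / real L" by (intro divide_right_mono) auto
      also have "\<dots> = 225 / 100 * (\<Lambda> / real L)" by simp
      also have "\<dots> \<le> 225 / 100 * (2248 / 10000 * 1)" unfolding \<Lambda>L using \<zeta> \<eta> by (intro mult_left_mono mult_mono) auto
      finally show "real S / real L \<le> 5058 / 10000" by simp
    qed simp
    finally have "4 * real B / real T \<le> 1001 / 1000 * (2 * real n) * (5058 / 10000)" .
    then have "ln (4 * real B / real T) \<le> ln (1001 / 1000 * (2 * real n) * (5058 / 10000))"
      using B0 T0 n0 by (subst ln_le_cancel_iff) auto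
    also have "\<dots> = ln (1001 / 1000) + ln (2 * real n) + ln (5058 / 10000)"
    proof -
      have "ln (x * y * w) = ln x + ln y + ln w" if "x > 0" "y > 0" "w > 0" for x y w :: real
        using that by (simp add: ln_mult)
      then show ?thesis by (rule) (use n0 in auto)
    qed
    also have "\<dots> \<le> 1 / 1000 + \<Lambda> * u - 65 / 100"
      using \<Lambda>u ln_5058 ln_le_minus_one[of "1001 / 1000"] by linarith
    finally have "ln (4 * real B / real T) \<le> 1 / 1000 + \<Lambda> * u - 65 / 100" .
    moreover have "ln (4 * real B * r / real T) = ln (4 * real B / real T) + ln r"
    proof -
      have "4 * real B * r / real T = (4 * real B / real T) * r" by simp
      then show ?thesis using B0 T0 r2 by (simp only:) (subst ln_mult, auto)
    qed
    ultimately have "ln (4 * real B * r / real T) + 1 \<le> \<Lambda> * u + u + 1441 / 1000"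
      using lnr by linarith
    then have "real T / 2 * (ln (4 * real B * r / real T) + 1) \<le> real T / 2 * (\<Lambda> * u + u + 1441 / 1000)"
      by (intro mult_left_mono) auto
    also have "\<dots> = N * ((\<Lambda> * u + u + 1441 / 1000) / (2 * (\<sigma> * \<Lambda> + 1)))"
      unfolding TN S\<sigma>[symmetric] by simp
    \<comment> \<open>The fraction decreases in \<Lambda> because \<sigma> exceeds 1, so
      \<open>\<Lambda> = 10\<close> is the worst case.\<close>
    also have "(\<Lambda> * u + u + 1441 / 1000) / (2 * (\<sigma> * \<Lambda> + 1)) \<le> (11 * u + 1441 / 1000) / (2 * (10 * \<sigma> + 1))"
    proof -
      have "0 \<le> (\<Lambda> - 10) * (\<sigma> * (u + 1441 / 1000) - u)"
        using \<Lambda>10 \<sigma> u17 mult_mono[of 1 \<sigma> u "u + 1441 / 1000"] by (intro mult_nonneg_nonneg) auto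
      moreover have "(11 * u + c) * (\<sigma> * \<Lambda> + 1) - (\<Lambda> * u + u + c) * (10 * \<sigma> + 1) = (\<Lambda> - 10) * (\<sigma> * (u + c) - u)" for c
        by (simp add: algebra_simps)
      ultimately have "(\<Lambda> * u + u + 1441 / 1000) * (10 * \<sigma> + 1) \<le> (11 * u + 1441 / 1000) * (\<sigma> * \<Lambda> + 1)"
        by (metis diff_ge_0_iff_ge)
      moreover have "\<sigma> * \<Lambda> + 1 > 0" "10 * \<sigma> + 1 > 0" using \<sigma> \<Lambda>10 by (auto intro: add_pos_pos)
      moreover have "x / (2 * s) \<le> w / (2 * t)" if "x * t \<le> w * s" "s > 0" "t > 0" for x w s t :: real
        using that by (simp add: divide_simps)
      ultimately show ?thesis by blast
    qed
    finally show ?thesis using N0 by simp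
  qed
  have t3: "real D * (real D + 3) / (2 * N) * ln r \<le> N * ((\<theta> * u + y)\<^sup>2 / (2 * (u + 109 / 100))) + 15 / 10 * ln r"
  proof -
    have "(real D * ln r)\<^sup>2 \<le> (N * (\<theta> * u + y))\<^sup>2" using DN lnr0 by (intro power_mono) auto
    then have "(real D * ln r)\<^sup>2 / (2 * N * ln r) \<le> (N * (\<theta> * u + y))\<^sup>2 / (2 * N * ln r)"
      using N0 lnr0 by (intro divide_right_mono) auto
    moreover have "(N * (\<theta> * u + y))\<^sup>2 / (2 * N * ln r) = N * ((\<theta> * u + y)\<^sup>2 / (2 * (u + 109 / 100)))"
      using N0 unfolding lnr by (simp add: power2_eq_square)
    moreover have "(real D * ln r)\<^sup>2 / (2 * N * ln r) = real D * real D / (2 * N) * ln r"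
      using lnr0 by (simp add: power2_eq_square)
    moreover have "real D * 3 / (2 * N) * ln r \<le> 15 / 10 * ln r"
      using DN' N0 lnr0 by (intro mult_right_mono) (auto simp: divide_simps)
    moreover have "real D * (real D + 3) / (2 * N) * ln r = real D * real D / (2 * N) * ln r + real D * 3 / (2 * N) * ln r"
      by (simp add: add_divide_distrib distrib_left distrib_right)
    ultimately show ?thesis by linarith
  qed
  have t4: "r * Y - real D * ln r \<le> N * (y / r) - N * (\<theta> * u) + ln (2 * real (L * S)) + ln r"
  proof -
    have "Y = N * (y / r)" using rY r2 by (simp add: field_simps)
    moreover have "r * Y - \<Xi> = Y - N * (\<theta> * u) + ln (2 * real (L * S))"
      unfolding \<Xi>_def M\<mu> by (simp add: algebra_simps)
    ultimately show ?thesis using D2 by linarith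
  qed
  \<comment> \<open>The logarithm of the denominators. Its main term comes from
    \<open>L * ln q\<close>, about \<open>L * M * ln a\<close>; the rest is free of
    \<open>M\<close>.\<close>
  have t5: "(real S - 1) * (real L * ln (real q) + real S * ln (real a) + real L * ln 4)
     \<le> N * (\<sigma> * \<zeta> * u / 2) + 4 * (real L * (real L)\<^sup>2) * ln (real a)"
  proof -
    have S1': "0 \<le> real S - 1" using S0 by simp
    have "real L * ln (real q) \<le> real L * ((real M + real S) * ln (real a))" using lnq2 by (intro mult_left_mono) auto
    also have "\<dots> = real L * real M * ln (real a) + real L * real S * ln (real a)" by (simp add: algebra_simps)
    also have "real L * real S * ln (real a) \<le> real L * real L * ln (real a)"
      using SL lna by (intro mult_right_mono mult_left_mono) auto
    finally have 1: "real L * ln (real q) \<le> real L * real M * ln (real a) + real L * real L * ln (real a)" by simp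
    have LL: "real L \<le> real L * real L" using L44 by simp
    have "real S * ln (real a) \<le> real L * real L * ln (real a)" using SL LL lna by (intro mult_right_mono) auto
    moreover have "real L * ln 4 \<le> 2 * (real L * real L * ln (real a))"
    proof -
      have "ln 4 = 2 * ln (2 :: real)" using ln_realpow[of 2 2] by simp
      then have "ln 4 \<le> 2 * ln (real a)" using ln_2_less_1 lna by simp
      then have "real L * ln 4 \<le> (real L * real L) * (2 * ln (real a))" using LL by (intro mult_mono) auto
      then show ?thesis by simp
    qed
    ultimately have "real L * ln (real q) + real S * ln (real a) + real L * ln 4
        \<le> real L * real M * ln (real a) + 4 * (real L * real L * ln (real a))" using 1 by linarith
    then have "(real S - 1) * (real L * ln (real q) + real S * ln (real a) + real L * ln 4)
        \<le> (real S - 1) * (real L * real M * ln (real a)) + (real S - 1) * (4 * (real L * real L * ln (real a)))"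
      using mult_left_mono[OF _ S1'] by (simp only: distrib_left[symmetric])
    also have "(real S - 1) * (4 * (real L * real L * ln (real a))) \<le> real L * (4 * (real L * real L * ln (real a)))"
      using SL lna by (intro mult_right_mono) auto
    also have "(real S - 1) * (real L * real M * ln (real a)) = N * (\<sigma> * \<zeta> * u / 2)"
    proof -
      have "N * (\<sigma> * \<zeta> * u / 2) = real M * (real L)\<^sup>2 * \<sigma> * (\<zeta> * \<eta>) * ln (real a)" by (simp add: N u_def)
      also have "\<dots> = \<sigma> * \<Lambda> * (real L * real M * ln (real a))"
        unfolding \<Lambda>L[symmetric] using L0 by (simp add: power2_eq_square)
      finally show ?thesis unfolding S\<sigma> by (rule sym)
    qed
    finally show ?thesis by (simp add: power2_eq_square mult_ac)
  qed
  have t6: "25 / 10 * ln r + ln (2 * real (L * S)) + 4 * (real L * (real L)\<^sup>2) * ln (real a) \<le> 5 / 10000 * N"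
  proof -
    define A where "A = real L * (real L)\<^sup>2 * ln (real a)"
    have L2: "1 \<le> (real L)\<^sup>2" using L44 by simp
    have L3: "1 \<le> real L * (real L)\<^sup>2" using L2 L44 mult_mono[of 1 "real L" 1 "(real L)\<^sup>2"] by simp
    have A1: "ln (real a) \<le> A" unfolding A_def using L3 lna mult_right_mono[of 1 _ "ln (real a)"] by simp
    have "(real L)\<^sup>2 * 1 \<le> (real L)\<^sup>2 * (real L * ln (real a))"
      using L44 lna mult_mono[of 1 "real L" 1 "ln (real a)"] by (intro mult_left_mono) auto
    then have A2: "(real L)\<^sup>2 \<le> A" by (simp add: A_def mult_ac)
    have "u \<le> 1 * ln (real a)" unfolding u_def using \<eta> lna by (intro mult_right_mono) auto
    then have "ln r \<le> 2 * A" using A1 lna lnr by linarith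
    then have "25 / 10 * ln r + ln (2 * real (L * S)) + 4 * A \<le> 11 * A" using ln2LS A2 by linarith
    also have "11 * A \<le> 5 / 10000 * N"
    proof -
      have "19000 * (real L * ln (real a)) \<le> 19000 * (real L * real a)" using lna' by (intro mult_left_mono) auto
      then have "19000 * (real L * ln (real a)) \<le> real M" using M by simp
      then have "19000 * (real L * ln (real a)) * (real L)\<^sup>2 \<le> real M * (real L)\<^sup>2" by (intro mult_right_mono) auto
      then have "19000 * A \<le> N / 2" by (simp add: A_def N mult_ac)
      then show ?thesis using N0 by linarith
    qed
    finally show ?thesis by (simp add: A_def mult.assoc)
  qed
  have total: "ln (real D + 3) + ln N + (lH + real T / 2) + (r * Y - real D * ln r)
     + (real S - 1) * (real L * ln (real q) + real S * ln (real a) + real L * ln 4) < 0"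
  proof -
    have "lH + real T / 2 = real T / 2 * (ln (4 * real B * r / real T) + 1) + real D * (real D + 3) / (2 * N) * ln r"
      by (simp add: lH_def algebra_simps)
    moreover define c1 where c1: "c1 = (11 * u + 1441 / 1000) / (2 * (10 * \<sigma> + 1))"
    define c2 where c2: "c2 = (\<theta> * u + y)\<^sup>2 / (2 * (u + 109 / 100))"
    define c3 where c3: "c3 = y / r"
    define c4 where c4: "c4 = \<sigma> * \<zeta> * u / 2"
    define c5 where c5: "c5 = \<theta> * u"
    have "N * (1 / 1000 + c1 + c2 + c3 + c4) < N * c5"
      using MI[folded c1 c2 c3 c4 c5] N0 by (rule mult_strict_left_mono)
    then have "N * (1 / 1000) + N * c1 + N * c2 + N * c3 + N * c4 < N * c5" by (simp only: distrib_left)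
    ultimately show ?thesis
      using t1 t2[folded c1] t3[folded c2] t4[folded c3 c5] t5[folded c4] t6 by linarith
  qed
  have small: "(real D + 3) * (real (S * T) * exp lH * exp (real T / 2 + r * Y) / r ^ D)
        * (real q ^ L * real a ^ S * 4 ^ L) ^ (S - 1) < 1"
  proof -
    have rD: "r ^ D = exp (real D * ln r)" using r2 by (simp add: exp_of_nat_mult)
    have w: "(real q ^ L * real a ^ S * 4 ^ L) ^ (S - 1) =
       exp ((real S - 1) * (real L * ln (real q) + real S * ln (real a) + real L * ln 4))"
    proof -
      have "real q ^ L * real a ^ S * 4 ^ L = exp (real L * ln (real q) + real S * ln (real a) + real L * ln 4)"
        using q1 a0 by (simp add: exp_add exp_of_nat_mult)
      moreover have "real (S - 1) = real S - 1" using S0 by simp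
      ultimately show ?thesis by (metis exp_of_nat_mult)
    qed
    have d: "real D + 3 = exp (ln (real D + 3))" by simp
    have nn: "real (S * T) = exp (ln N)" using N0 by (simp add: N_def)
    have "(real D + 3) * (real (S * T) * exp lH * exp (real T / 2 + r * Y) / r ^ D)
        * (real q ^ L * real a ^ S * 4 ^ L) ^ (S - 1) =
      exp (ln (real D + 3)) * (exp (ln N) * exp lH * exp (real T / 2 + r * Y) / exp (real D * ln r))
        * exp ((real S - 1) * (real L * ln (real q) + real S * ln (real a) + real L * ln 4))"
      unfolding rD w nn using d by simp
    also have "\<dots> = exp (ln (real D + 3) + ln N + (lH + real T / 2) + (r * Y - real D * ln r)
     + (real S - 1) * (real L * ln (real q) + real S * ln (real a) + real L * ln 4))"
      by (simp only: exp_add exp_diff times_divide_eq_right times_divide_eq_left mult_ac)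
    also have "\<dots> < 1" using total by simp
    finally show ?thesis .
  qed
  show False
  proof (rule no_good_approximation[where a = a and b = b and n = n and p = P and q = q and S = S and L = L and j = j
        and D = D and v = v and w = "real P / real q" and H = "exp lH" and r = r and Y = Y and \<epsilon> = \<epsilon>])
    show "a \<le> 2 * b" using a65 by linarith
    show "a ^ (S * j) \<le> q" using aM by (simp add: M_def)
    show "Y = (real S - 1) / 2 * v * real (n * (S * j * L + S) + L)" by (simp add: Y_def B_def M_def)
    show "real D * ln 2 + real D * (real D + 1) / 2 * ln r + real S * (real (2 * j * L\<^sup>2) * (real (2 * j * L\<^sup>2) - 1) / 2) *
          ln (4 * real (n * (S * j * L + S) + L) * r / real (2 * j * L\<^sup>2)) \<le> real (S * (2 * j * L\<^sup>2)) * ln (exp lH)"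
      using count unfolding B_def M_def T_def .
    show "(real D + 3) * (real (S * (2 * j * L\<^sup>2)) * exp lH * exp (real (2 * j * L\<^sup>2) / 2 + r * Y) / r ^ D) *
         (real q ^ L * real a ^ S * 4 ^ L) ^ (S - 1) < 1"
      using small unfolding T_def .
  qed (use b ab S0 L0 j0 nL P q1 Pq v_def rel \<epsilon>2 r2 close in auto)
qed

section \<open>The explicit constant, uniform in a, b and n\<close>

theorem theorem2p1:
  shows "\<exists>C. computable_real_fn 4 C \<and>
    (\<forall>(a::int) (b::int) (n::int) (\<eta>::real).
      n \<ge> 3 \<longrightarrow> 16 < b \<longrightarrow> b < a \<longrightarrow> real_of_int a < 6 * real_of_int b / 5 \<longrightarrow>
      0 < \<eta> \<longrightarrow> \<eta> \<le> 1 \<longrightarrow> real_of_int (a - b) = real_of_int a powr (1 - \<eta>) \<longrightarrow>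
      root (nat n) (real_of_int a / real_of_int b) \<notin> \<rat> \<longrightarrow>
      mu_eff (\<lambda>k. C [nat a, nat b, nat n, k]) (root (nat n) (real_of_int a / real_of_int b))
        \<le> ereal (35.1 / \<eta> * (max (ln (2 * real_of_int n) / (\<eta> * ln (real_of_int a))) 10)\<^sup>2))"
proof (intro exI conjI allI impI)
  \<comment> \<open>The inner power of \<open>a\<close> is the threshold \<open>Q\<close> for large
    denominators, and \<open>h\<close> is the denominator of Liouville's bound at
    \<open>q = Q\<close>. The index of \<epsilon> does not occur because the exponent \<mu> itself
    is attained.\<close>
  define h :: "nat list \<Rightarrow> nat" where
    "h xs = xs ! 1 * xs ! 2 * 3 ^ (xs ! 2) * (xs ! 0 ^ (2000000 * xs ! 2 * (xs ! 0)\<^sup>2)) ^ (xs ! 2)" for xs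
  have "recursive_fn 4 h"
    unfolding h_def by (intro recursive_mult recursive_power recursive_const recursive_fn.proj) simp_all
  then show "computable_real_fn 4 (\<lambda>xs. 1 / real (Suc (h xs)))" by (rule computable_inverse)
  fix a b n :: int and \<eta> :: real
  assume n: "n \<ge> 3" and b: "16 < b" and ab: "b < a" and a65: "real_of_int a < 6 * real_of_int b / 5"
    and \<eta>: "0 < \<eta>" "\<eta> \<le> 1" and eq: "real_of_int (a - b) = real_of_int a powr (1 - \<eta>)"
    and irr: "root (nat n) (real_of_int a / real_of_int b) \<notin> \<rat>"
  define a' b' n' where "a' = nat a" and "b' = nat b" and "n' = nat n"
  have conv: "real_of_int a = real a'" "real_of_int b = real b'" "real_of_int n = real n'"
    using n b ab by (auto simp: a'_def b'_def n'_def)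
  define \<Lambda> where "\<Lambda> = max (ln (2 * real n') / (\<eta> * ln (real a'))) 10"
  define \<mu> where "\<mu> = 35.1 / \<eta> * \<Lambda>\<^sup>2"
  define \<xi> where "\<xi> = root n' (real a' / real b')"
  define Q where "Q = a' ^ (2000000 * n' * a'\<^sup>2)"
  define K where "K = real b' * real n' * 3 ^ n'"
  define C where "C k = 1 / real (Suc (h [a', b', n', k]))" for k
  have \<mu>0: "\<mu> \<ge> 0" using \<eta> by (simp add: \<mu>_def)
  have n0: "n' > 0" and b0: "b' > 16" "b' > 0" and ab': "b' < a'" using n b ab by (auto simp: n'_def b'_def a'_def)
  have a65': "real a' < 6 * real b' / 5" using a65 by (simp add: conv)
  have Q1: "real Q \<ge> 1"
  proof -
    have "Q \<ge> 1" using ab' by (simp add: Q_def Suc_le_eq)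
    then have "real 1 \<le> real Q" by (simp only: of_nat_le_iff)
    then show ?thesis by simp
  qed
  have K1: "K \<ge> 1"
  proof -
    have "1 \<le> b' * n' * 3 ^ n'" using b0 n0 by (simp add: Suc_le_eq)
    then have "real 1 \<le> real (b' * n' * 3 ^ n')" by (simp only: of_nat_le_iff)
    then show ?thesis by (simp add: K_def)
  qed
  have hK: "real (h [a', b', n', k]) = K * real Q ^ n'" for k by (simp add: h_def K_def Q_def)
  have KQ: "K \<le> K * real Q ^ n'" using K1 Q1 by simp
  have C0: "C k > 0" for k by (simp add: C_def)
  have C1: "C k < 1 / (K * real Q ^ n')" for k
  proof -
    have "1 / (1 + x) < 1 / x" if "x > 0" for x :: real using that by (simp add: divide_simps)
    moreover have "K * real Q ^ n' > 0" using K1 KQ by linarith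
    ultimately show ?thesis unfolding C_def of_nat_Suc hK by blast
  qed
  have C2: "C k < 1 / K" for k
  proof -
    have "1 / (K * real Q ^ n') \<le> 1 / K" by (rule frac_le) (use KQ K1 in auto)
    then show ?thesis using C1[of k] by linarith
  qed
  have C3: "C k < 1" for k
  proof -
    have "1 / K \<le> 1" using K1 by simp
    then show ?thesis using C2[of k] by linarith
  qed
  have "irrationality_measure_with C \<xi> \<mu>"
    unfolding irrationality_measure_with_def
  proof (intro allI impI conjI)
    fix \<epsilon> :: real and k :: nat and p q :: int
    assume \<epsilon>: "\<epsilon> > 0" and q: "q \<ge> 1"
    define q' where "q' = nat q"
    have q': "real_of_int q = real q'" "q' > 0" "real q' \<ge> 1" using q by (auto simp: q'_def)
    have liou: "1 / (K * real q' ^ n') \<le> \<bar>\<xi> - of_int p / real q'\<bar>"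
      unfolding \<xi>_def K_def
      by (rule liouville_root) (use b0 n0 q' a65' irr in \<open>auto simp: conv n'_def\<close>)
    have "C k * real q' powr (- \<mu> - \<epsilon>) \<le> C k * real q' powr (- \<mu>)"
      using C0[of k] q' \<epsilon> by (intro mult_left_mono powr_mono) auto
    \<comment> \<open>If \<open>n \<le> \<mu>\<close>, Liouville's exponent is good enough.
      Otherwise denominators from \<open>Q\<close> on fall under the auxiliary function argument,
      and smaller ones are paid for by the factor \<open>Q ^ n\<close> inside
      \<open>C k\<close>.\<close>
    also have "\<dots> < \<bar>\<xi> - of_int p / real q'\<bar>"
    proof (cases "real n' \<le> \<mu>")
      case True
      have "C k * real q' powr (- \<mu>) < 1 / K * real q' powr (- \<mu>)"
        using C2[of k] q' by (intro mult_strict_right_mono) auto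
      also have "\<dots> \<le> 1 / K * real q' powr (- real n')"
        using True q' K1 by (intro mult_left_mono powr_mono) auto
      also have "\<dots> = 1 / (K * real q' ^ n')" using q' by (simp add: powr_minus powr_realpow divide_inverse)
      finally show ?thesis using liou by linarith
    next
      case large: False
      show ?thesis
      proof (cases "Q \<le> q'")
        case True
        have "C k * real q' powr (- \<mu>) < 1 * real q' powr (- \<mu>)"
          using C3[of k] q' by (intro mult_strict_right_mono) auto
        also have "\<dots> \<le> \<bar>\<xi> - of_int p / real q'\<bar>"
          unfolding \<xi>_def mult_1
          by (rule large_denominator[OF \<mu>_def b0(1) ab' a65' \<eta> _ \<Lambda>_def])
            (use eq large True in \<open>auto simp: conv Q_def\<close>)
        finally show ?thesis .
      next
        case False
        have "C k * real q' powr (- \<mu>) \<le> C k * 1"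
          using C0[of k] q' \<mu>0 powr_mono[of "- \<mu>" 0 "real q'"] by (intro mult_left_mono) auto
        also have "\<dots> < 1 / (K * real Q ^ n')" using C1[of k] by simp
        also have "\<dots> \<le> 1 / (K * real q' ^ n')"
          using False q' K1 Q1 by (intro divide_left_mono mult_left_mono power_mono mult_pos_pos) auto
        finally show ?thesis using liou by linarith
      qed
    qed
    finally show "C k * real_of_int q powr (- \<mu> - \<epsilon>) < \<bar>\<xi> - real_of_int p / real_of_int q\<bar>"
      by (simp add: q')
  qed (rule C0)
  then have "mu_eff C \<xi> \<le> ereal \<mu>"
    unfolding mu_eff_def by (intro Inf_lower) auto
  then show "mu_eff (\<lambda>k. 1 / real (Suc (h [nat a, nat b, nat n, k]))) (root (nat n) (real_of_int a / real_of_int b))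
        \<le> ereal (35.1 / \<eta> * (max (ln (2 * real_of_int n) / (\<eta> * ln (real_of_int a))) 10)\<^sup>2)"
    unfolding conv C_def \<xi>_def \<mu>_def \<Lambda>_def a'_def b'_def n'_def .
qed

end
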